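(* Let $g(x)=\alpha x^{q^k}+\beta x$ with $\alpha\in\mathbb{F}_{q^n}^*$, $\beta\in\mathbb{F}_{q^n}$, $1\le k<n$, and let $f(y)=\sum_{i=0}^d a_iy^{q^i}\in\mathbb{F}_{q^n}[y]$, $0\le d<n$, $a_d\ne0$, be not a monomial. Let $0\le h<n$ with $h>\ell$. If $f$ is a binomial and $h=d$, assume moreover $a_h\ne\beta$. Define \[m_h=\begin{cases}\max\{d,h\} & \text{if } a_d\ne\beta \text{ or } d\ne h,\\ \ell_3 & \text{if } a_d=\beta \text{ and } d=h.\end{cases}\] If $k+m_h-\ell\le n/2$, then $L_g\cap L_f\ne\emptyset$.
   Context: Let $q$ be a prime power, $n\ge2$. For $f(y)=\sum_{i=0}^d a_iy^{q^i}$ with $a_d\neq0$: $\ell=\min\{i: a_i\ne0\}$; when $f$ is not a monomial (i.e. has at least two nonzero coefficients), $\ell_2=\min\{i>\ell: a_i\ne0\}$ and $\ell_3=\max\{i<d:a_i\ne0\}$; $f$ is a binomial if it has exactly two nonzero coefficients. Coefficients $a_i$ with $i$ outside the support are $0$. For an integer $0\le h<n$: $L_g=\{\langle(x,g(x))\rangle_{\mathbb{F}_{q^n}}:x\in\mathbb{F}_{q^n}^*\}$ and $L_f=\{\langle(y^{q^h},f(y))\rangle_{\mathbb{F}_{q^n}}:y\in\mathbb{F}_{q^n}^*\}$, points of $\mathrm{PG}(1,q^n)$. *)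

theory Defs
  imports "HOL-Computational_Algebra.Primes"
begin

definition linpoly :: "nat \<Rightarrow> nat \<Rightarrow> (nat \<Rightarrow> 'a::field) \<Rightarrow> 'a \<Rightarrow> 'a" where
  "linpoly q d a y = (\<Sum>i\<le>d. a i * y ^ (q ^ i))"

definition lin_support :: "nat \<Rightarrow> (nat \<Rightarrow> 'a::field) \<Rightarrow> nat set" where
  "lin_support d a = {i. i \<le> d \<and> a i \<noteq> 0}"

definition ell :: "nat \<Rightarrow> (nat \<Rightarrow> 'a::field) \<Rightarrow> nat" where
  "ell d a = Min (lin_support d a)"

definition ell3 :: "nat \<Rightarrow> (nat \<Rightarrow> 'a::field) \<Rightarrow> nat" where
  "ell3 d a = Max (lin_support d a - {d})"

definition is_monomial :: "nat \<Rightarrow> (nat \<Rightarrow> 'a::field) \<Rightarrow> bool" where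
  "is_monomial d a \<longleftrightarrow> card (lin_support d a) = 1"

definition is_binomial :: "nat \<Rightarrow> (nat \<Rightarrow> 'a::field) \<Rightarrow> bool" where
  "is_binomial d a \<longleftrightarrow> card (lin_support d a) = 2"

(* the point <(u,v)>_{F} of PG(1,F): the 1-dim subspace spanned by (u,v) *)
definition pg_point :: "'a::field \<Rightarrow> 'a \<Rightarrow> ('a \<times> 'a) set" where
  "pg_point u v = {(c * u, c * v) | c. True}"

definition L_g :: "('a::field \<Rightarrow> 'a) \<Rightarrow> ('a \<times> 'a) set set" where
  "L_g g = {pg_point x (g x) | x. x \<noteq> 0}"

definition L_f :: "nat \<Rightarrow> nat \<Rightarrow> ('a::field \<Rightarrow> 'a) \<Rightarrow> ('a \<times> 'a) set set" where
  "L_f q h f = {pg_point (y ^ (q ^ h)) (f y) | y. y \<noteq> 0}"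

definition m_h :: "nat \<Rightarrow> nat \<Rightarrow> (nat \<Rightarrow> 'a::field) \<Rightarrow> 'a \<Rightarrow> nat" where
  "m_h h d a \<beta> = (if a d \<noteq> \<beta> \<or> d \<noteq> h then max d h else ell3 d a)"

end

theory Submission
  imports Defs "HOL-Algebra.Algebraic_Closure_Type"
begin

hide_const (open) Divisibility.prime

text \<open>
  Two points coincide iff \<open>\<alpha> x\<^sup>D y\<^sup>H = F y\<close> for some \<open>x, y \<noteq> 0\<close>, where \<open>D = q\<^sup>k - 1\<close>,
  \<open>H = q\<^sup>h\<close> and \<open>F y = f y - \<beta> y\<^sup>H\<close>. Extracting \<open>q\<^sup>\<ell>\<close>-th roots makes \<open>F\<close> a separable
  linearized polynomial, which has at most \<open>M = q\<^bsup>m - \<ell>\<^esup>\<close> distinct roots. Detecting \<open>D\<close>-th powers in the field \<open>\<bbbF>\<close> with \<open>Q = q\<^sup>n\<close> elements by multiplicative characters,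
  a solution exists as soon as \<open>(D - 1) (M - 1) \<surd>Q < Q - M\<close>, by Weil's bound
  \<open>\<bar>\<Sum>y. \<chi> (g y)\<bar> \<le> (M - 1) \<surd>Q\<close> for a polynomial \<open>g\<close> with \<open>M\<close> distinct roots, one of them simple.

  Weil's bound is proved by the elementary method of Stepanov and Bombieri. Let \<open>S\<^sub>s\<close> be the analogous sum
  over the extension of degree \<open>s\<close>. Stepanov's auxiliary polynomial bounds each fibre of the norm of \<open>g\<close>
  and gives \<open>S\<^sub>s = O(\<surd>Q\<^sup>s)\<close>. The sums \<open>A\<^sub>m\<close> of \<open>\<chi> (Res (p, g))\<close> over the monic polynomials \<open>p\<close> of degree
  \<open>m\<close> over \<open>\<bbbF>\<close> satisfy Newton's identities \<open>m A\<^sub>m = \<Sum>s=1..m. S\<^sub>s A\<^bsub>m - s\<^esub>\<close> and vanish for \<open>m \<ge> M\<close>. So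
  \<open>L = \<Sum>m. A\<^sub>m T\<^sup>m\<close> is a polynomial of degree less than \<open>M\<close> with \<open>T L' = (\<Sum>s. S\<^sub>s T\<^sup>s) L\<close>; its roots lie
  outside the disc of convergence of that power series, so \<open>\<bar>S\<^sub>1\<bar> = \<bar>A\<^sub>1\<bar>\<close> is at most \<open>(M - 1) \<surd>Q\<close>.
\<close>

section \<open>Stepanov's auxiliary polynomial\<close>

text \<open>More than \<open>n\<close> vectors in the \<open>n\<close>-dimensional space of
  polynomials of degree below \<open>n\<close>: Gaussian elimination, one coefficient at a time from
  the top, with a pivot \<open>p i0\<close>.\<close>

lemma poly_family_dependent:
  fixes p :: "'i \<Rightarrow> 'a::field poly"
  assumes "finite I" "n < card I" "\<And>i k. i \<in> I \<Longrightarrow> k \<ge> n \<Longrightarrow> coeff (p i) k = 0"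
  shows "\<exists>r. (\<exists>i\<in>I. r i \<noteq> 0) \<and> (\<Sum>i\<in>I. smult (r i) (p i)) = 0"
  using assms
proof (induction n arbitrary: I p)
  case 0
  then obtain i where "i \<in> I" by fastforce
  moreover have "p i = 0" if "i \<in> I" for i
    using 0 that by (intro poly_eqI) auto
  ultimately show ?case
    by (intro exI[of _ "\<lambda>_. 1"]) auto
next
  case (Suc n)
  show ?case
  proof (cases "\<forall>i\<in>I. coeff (p i) n = 0")
    case True
    have "coeff (p i) k = 0" if "i \<in> I" "k \<ge> n" for i k
      using True Suc.prems(3)[OF that(1), of k] that by (cases "k = n") auto
    then show ?thesis
      using Suc.IH[of I p] Suc.prems by auto
  next
    case False
    then obtain i0 where i0: "i0 \<in> I" "coeff (p i0) n \<noteq> 0" by blast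
    define I' where "I' = I - {i0}"
    define c where "c i = coeff (p i) n / coeff (p i0) n" for i
    define p' where "p' i = p i - smult (c i) (p i0)" for i
    have "coeff (p' i) k = 0" if "i \<in> I'" "k \<ge> n" for i k
      using Suc.prems(3)[of i k] Suc.prems(3)[of i0 k] that i0
      by (cases "k = n") (auto simp: p'_def c_def I'_def)
    moreover have "finite I'" "n < card I'"
      using Suc.prems i0 by (auto simp: I'_def)
    ultimately obtain r where r: "\<exists>i\<in>I'. r i \<noteq> 0" "(\<Sum>i\<in>I'. smult (r i) (p' i)) = 0"
      using Suc.IH[of I' p'] by blast
    \<comment> \<open>The coefficient of the pivot compensates for the multiples of
      \<open>p i0\<close> subtracted in the elimination.\<close>
    define R where "R i = (if i = i0 then - (\<Sum>i\<in>I'. r i * c i) else r i)" for i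
    have "(\<Sum>i\<in>I. smult (R i) (p i)) = smult (R i0) (p i0) + (\<Sum>i\<in>I'. smult (R i) (p i))"
      unfolding I'_def using Suc.prems i0 by (intro sum.remove) auto
    also have "(\<Sum>i\<in>I'. smult (R i) (p i)) = (\<Sum>i\<in>I'. smult (r i) (p i))"
      by (intro sum.cong) (auto simp: R_def I'_def)
    also have "\<dots> = (\<Sum>i\<in>I'. smult (r i) (p' i) + smult (r i * c i) (p i0))"
      by (intro sum.cong) (auto simp: p'_def algebra_simps smult_diff_right)
    also have "\<dots> = smult (\<Sum>i\<in>I'. r i * c i) (p i0)"
      by (simp add: sum.distrib r(2) smult_sum)
    finally have "(\<Sum>i\<in>I. smult (R i) (p i)) = 0"
      by (simp add: R_def)
    moreover have "\<exists>i\<in>I. R i \<noteq> 0"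
      using r(1) by (auto simp: R_def I'_def)
    ultimately show ?thesis by blast
  qed
qed

text \<open>The summand of least order at \<open>w\<close> cannot cancel: all others are divisible
  by a higher power of \<open>X - w\<close>.\<close>

lemma sum_nonzero_if_distinct_orders:
  fixes p :: "'t \<Rightarrow> 'a::field poly"
  assumes T: "finite T" "T \<noteq> {}" and nz: "\<And>t. t \<in> T \<Longrightarrow> p t \<noteq> 0"
    and inj: "inj_on (\<lambda>t. order w (p t)) T"
  shows "(\<Sum>t\<in>T. p t) \<noteq> 0"
proof
  assume sum0: "(\<Sum>t\<in>T. p t) = 0"
  obtain t0 where t0: "t0 \<in> T" "\<And>t. t \<in> T \<Longrightarrow> order w (p t0) \<le> order w (p t)"
    using T arg_min_if_finite(1)[OF T, of "\<lambda>t. order w (p t)"] arg_min_least[OF T, of _ "\<lambda>t. order w (p t)"]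
    by blast
  define m where "m = order w (p t0)"
  have "[:-w, 1:] ^ Suc m dvd p t" if "t \<in> T - {t0}" for t
  proof -
    have "order w (p t) \<noteq> m"
      using inj that t0(1) by (auto simp: inj_on_def m_def)
    then show ?thesis
      using t0(2)[of t] that by (auto simp: order_divides m_def simp del: power_Suc)
  qed
  then have "[:-w, 1:] ^ Suc m dvd (\<Sum>t\<in>T - {t0}. p t)"
    by (rule dvd_sum)
  moreover have "p t0 = - (\<Sum>t\<in>T - {t0}. p t)"
    using sum0 sum.remove[OF T(1) t0(1), of p] by (simp add: eq_neg_iff_add_eq_0)
  ultimately have "[:-w, 1:] ^ Suc m dvd p t0"
    by (simp del: power_Suc)
  then show False
    using nz[OF t0(1)] by (auto simp: order_divides m_def simp del: power_Suc)
qed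

lemma order_power:
  fixes p :: "'a::field poly"
  assumes "p \<noteq> 0"
  shows "order w (p ^ n) = n * order w p"
  using assms by (induction n) (auto simp: order_mult)

text \<open>
  The auxiliary polynomial \<open>\<Phi>\<close> is the sum of \<open>u i j * (X - w) ^ (i * t) * g ^ (j * m)\<close> with \<open>u i j\<close> of
  degree below \<open>A \<le> m\<close>. At the simple root \<open>w\<close> the summands have pairwise different orders, so \<open>\<Phi> \<noteq> 0\<close>.
  On the set to be counted, \<open>\<Phi> ^ s\<close> agrees up to a power of \<open>g\<close> with a polynomial of small degree depending
  linearly on the \<open>s\<close>-th powers of the coefficients, which can therefore be chosen to make it vanish.
\<close>
lemma stepanov_bound:
  fixes g :: "'k::alg_closed_field poly"
  assumes char: "prime CHAR('k)" "s = CHAR('k) ^ e1" "t = CHAR('k) ^ e2"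
    and st: "t = D * m + 1" "s = D * m' + 1" "m > 0"
    and g0: "g \<noteq> 0" and w: "order w g = 1" and A: "A \<le> m" and c: "c \<noteq> 0"
    and unknowns: "s * A + I + (D - 1) * m' * degree g < D * A * I"
  shows "finite {y. y ^ (t * s) = y \<and> poly g y ^ (m * s + m') = c}" (is "finite ?Z")
    and "card {y. y ^ (t * s) = y \<and> poly g y ^ (m * s + m') = c} \<le> A + I * t + (D - 1) * m * degree g"
proof -
  define J where "J = {..<I} \<times> {..<D} \<times> {..<A}"
  define R where "R = t * s"
  define B where "B = degree g"
  have D: "D > 0" using unknowns by (cases D) auto
  have spos: "s > 0" and tpos: "t > 0" using st by auto
  \<comment> \<open>Up to the factor \<open>r x\<close>, \<open>cp x\<close> represents the
    \<open>s\<close>-th power of one term of \<Phi> times \<open>g ^ ((D - 1) * m')\<close>. On the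
    counted set \<open>y ^ R = y\<close> turns \<open>(y - w) ^ (i * t * s)\<close> into
    \<open>(y - w ^ R) ^ i\<close>, and the fibre equation turns \<open>g ^ (j * m * s)\<close> into
    \<open>c ^ j\<close> over \<open>g ^ (j * m')\<close>.\<close>
  define cp where "cp = (\<lambda>(i, j, l). smult (c ^ j) (monom 1 (s * l) * [:- (w ^ R), 1:] ^ i * g ^ ((D - 1 - j) * m')))"
  define nn where "nn = s * A + I + (D - 1) * m' * B"
  have deg_cp: "coeff (cp x) k = 0" if "x \<in> J" "k \<ge> nn" for x k
  proof -
    obtain i j l where x: "x = (i, j, l)" by (cases x) auto
    have ijl: "i < I" "j < D" "l < A" using that x by (auto simp: J_def)
    have "degree (cp x) \<le> degree (monom (1::'k) (s * l) * [:- (w ^ R), 1:] ^ i * g ^ ((D - 1 - j) * m'))"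
      by (simp add: x cp_def)
    also have "\<dots> \<le> degree (monom (1::'k) (s * l)) + degree ([:- (w ^ R), 1:] ^ i) + degree (g ^ ((D - 1 - j) * m'))"
      by (meson add_le_mono degree_mult_le le_refl le_trans)
    also have "\<dots> \<le> s * l + i + (D - 1 - j) * m' * B"
      using degree_power_le[of g "(D - 1 - j) * m'"]
      by (simp add: degree_monom_eq degree_linear_power B_def mult.commute)
    also have "\<dots> < nn"
    proof -
      have "s * l \<le> s * A" using ijl by simp
      moreover have "(D - 1 - j) * m' * B \<le> (D - 1) * m' * B" by (intro mult_right_mono) auto
      ultimately show ?thesis using ijl unfolding nn_def by linarith
    qed
    finally show ?thesis using that(2) by (intro coeff_eq_0) simp
  qed
  have "finite J" "nn < card J"
    using unknowns by (auto simp: J_def nn_def B_def mult_ac)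
  then obtain r where r: "\<exists>x\<in>J. r x \<noteq> 0" "(\<Sum>x\<in>J. smult (r x) (cp x)) = 0"
    using poly_family_dependent[of J nn cp] deg_cp by blast
  \<comment> \<open>The linear system determines the \<open>s\<close>-th powers of the coefficients;
    algebraic closedness supplies the coefficients \<open>\<pi> x\<close> themselves.\<close>
  have "\<exists>z. z ^ s = r x" for x
    using nth_root_exists[OF spos, of "r x"] by blast
  then obtain \<pi> where \<pi>: "\<And>x. \<pi> x ^ s = r x" by metis
  define u where "u i j = (\<Sum>l<A. monom (\<pi> (i, j, l)) l)" for i j
  define trm where "trm = (\<lambda>(i, j). u i j * [:-w, 1:] ^ (i * t) * g ^ (j * m))"
  define \<Phi> where "\<Phi> = (\<Sum>x\<in>{..<I} \<times> {..<D}. trm x)"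
  define T where "T = {(i, j). i < I \<and> j < D \<and> u i j \<noteq> 0}"
  have coeff_u: "coeff (u i j) l = (if l < A then \<pi> (i, j, l) else 0)" for i j l
    by (auto simp: u_def coeff_sum if_distrib sum.delta cong: if_cong)
  have deg_u: "degree (u i j) \<le> A - 1" for i j
    by (intro degree_le) (auto simp: coeff_u)
  have "\<Phi> = (\<Sum>x\<in>T. trm x)"
    unfolding \<Phi>_def by (intro sum.mono_neutral_right) (auto simp: T_def trm_def)
  moreover have "(\<Sum>x\<in>T. trm x) \<noteq> 0"
  proof (rule sum_nonzero_if_distinct_orders[where w = w])
    show "finite T" by (rule finite_subset[of _ "{..<I} \<times> {..<D}"]) (auto simp: T_def)
    obtain i j l where "(i, j, l) \<in> J" "r (i, j, l) \<noteq> 0" using r(1) by auto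
    then have "u i j \<noteq> 0" "i < I" "j < D"
      using coeff_u[of i j l] \<pi>[of "(i, j, l)"] spos by (auto simp: J_def zero_power)
    then show "T \<noteq> {}" by (auto simp: T_def)
    show "trm x \<noteq> 0" if "x \<in> T" for x
      using that g0 by (auto simp: T_def trm_def)
    have ord: "order w (trm (i, j)) = order w (u i j) + i * t + j * m" if "(i, j) \<in> T" for i j
      using that g0 w
      by (auto simp: T_def trm_def order_mult order_power order_power_n_n)
    have ou: "order w (u i j) < m" if "(i, j) \<in> T" for i j
    proof -
      have "A > 0"
      proof (rule ccontr)
        assume "\<not> A > 0"
        then show False using that by (auto simp: T_def u_def)
      qed
      moreover have "order w (u i j) \<le> degree (u i j)"
        using that by (intro order_degree) (auto simp: T_def)
      ultimately show ?thesis using deg_u[of i j] A by linarith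
    qed
    have lt: "order w (u i j) + j * m < t" if "(i, j) \<in> T" for i j
    proof -
      have "j * m + m \<le> D * m"
        using that mult_right_mono[of "Suc j" D m] by (auto simp: T_def)
      then show ?thesis using ou[OF that] st by linarith
    qed
    \<comment> \<open>The orders are numbers in mixed radix: the remainder below \<open>t\<close>
      and the digit below \<open>m\<close> are bounded by \<open>lt\<close> and \<open>ou\<close>,
      so division by \<open>t\<close> and then by \<open>m\<close> recovers \<open>i\<close> and
      \<open>j\<close>.\<close>
    show "inj_on (\<lambda>x. order w (trm x)) T"
    proof (rule inj_onI, clarify)
      fix i j i' j' assume T: "(i, j) \<in> T" "(i', j') \<in> T"
        and eq: "order w (trm (i, j)) = order w (trm (i', j'))"
      have e: "order w (trm (i, j)) = (order w (u i j) + j * m) + i * t" if "(i, j) \<in> T" for i j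
        using ord[OF that] by (simp only: ac_simps)
      have q: "order w (trm (i, j)) div t = i" if "(i, j) \<in> T" for i j
        unfolding e[OF that] using lt[OF that] by simp
      have ii: "i = i'"
        using q[OF T(1)] q[OF T(2)] unfolding eq by (rule trans[OF sym])
      have "(order w (u i j) + j * m) + i * t = (order w (u i' j') + j' * m) + i' * t"
        unfolding e[OF T(1), symmetric] e[OF T(2), symmetric] by (rule eq)
      then have eq2: "order w (u i j) + j * m = order w (u i' j') + j' * m"
        unfolding ii by (simp only: add_right_cancel)
      have q2: "(order w (u i j) + j * m) div m = j" if "(i, j) \<in> T" for i j
        using ou[OF that] st(3) by simp
      have "j = j'"
        using q2[OF T(1)] q2[OF T(2)] unfolding eq2 by (rule trans[OF sym])
      then       show "i = i' \<and> j = j'" using ii by simp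
    qed
  qed
  ultimately have \<Phi>0: "\<Phi> \<noteq> 0" by simp
  note frob = freshmans_dream_sum'[OF char(1,2)]
  have frobR: "(y - w) ^ R = y ^ R - w ^ R" for y
  proof -
    have "R = CHAR('k) ^ (e1 + e2)" by (simp add: R_def char power_add)
    from freshmans_dream'[OF char(1) this, of "y - w" w] show ?thesis by simp
  qed
  have mm: "m * s + m' > 0" using st spos by simp
  have zero: "poly \<Phi> y = 0" if "y \<in> ?Z" for y
  proof -
    have y: "y ^ R = y" "poly g y ^ (m * s + m') = c" using that by (auto simp: R_def)
    have gy: "poly g y \<noteq> 0" using y(2) c mm by (auto simp: zero_power)
    have "poly \<Phi> y = (\<Sum>x\<in>{..<I} \<times> {..<D}. poly (trm x) y)"
      by (simp add: \<Phi>_def poly_sum)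
    also have "\<dots> = (\<Sum>x\<in>{..<I} \<times> {..<D}. \<Sum>l<A. \<pi> (fst x, snd x, l) * y ^ l * (y - w) ^ (fst x * t) * poly g y ^ (snd x * m))"
      by (intro sum.cong) (auto simp: trm_def u_def poly_sum poly_monom sum_distrib_right sum_distrib_left mult_ac)
    also have "\<dots> = (\<Sum>x\<in>J. case x of (i, j, l) \<Rightarrow> \<pi> x * y ^ l * (y - w) ^ (i * t) * poly g y ^ (j * m))"
      unfolding J_def by (simp add: sum.cartesian_product')
    finally have "poly \<Phi> y ^ s = (\<Sum>x\<in>J. (case x of (i, j, l) \<Rightarrow> \<pi> x * y ^ l * (y - w) ^ (i * t) * poly g y ^ (j * m)) ^ s)"
      by (simp add: frob)
    then have "poly \<Phi> y ^ s * poly g y ^ ((D - 1) * m') =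
      (\<Sum>x\<in>J. (case x of (i, j, l) \<Rightarrow> \<pi> x * y ^ l * (y - w) ^ (i * t) * poly g y ^ (j * m)) ^ s * poly g y ^ ((D - 1) * m'))"
      by (simp add: sum_distrib_right)
    also have "\<dots> = (\<Sum>x\<in>J. poly (smult (r x) (cp x)) y)"
    proof (intro sum.cong refl)
      fix x assume "x \<in> J"
      then obtain i j l where x: "x = (i, j, l)" "i < I" "j < D" "l < A" by (auto simp: J_def)
      have "(y - w) ^ (i * t * s) = ((y - w) ^ R) ^ i"
        unfolding power_mult[symmetric] R_def by (simp only: mult_ac)
      then have "(y - w) ^ (i * t * s) = (y - w ^ R) ^ i"
        using frobR[of y] y by simp
      moreover have "poly g y ^ (j * m * s) * poly g y ^ ((D - 1) * m') = c ^ j * poly g y ^ ((D - 1 - j) * m')"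
      proof -
        have "(D - 1) * m' = j * m' + (D - 1 - j) * m'"
          using x(3) by (simp flip: add_mult_distrib)
        moreover have "(m * s + m') * j = j * m * s + j * m'" by (simp add: algebra_simps)
        ultimately have "poly g y ^ (j * m * s) * poly g y ^ ((D - 1) * m') = (poly g y ^ (m * s + m')) ^ j * poly g y ^ ((D - 1 - j) * m')"
          unfolding power_mult[symmetric] by (simp only: power_add mult.assoc)
        then show ?thesis using y by simp
      qed
      moreover have "(case x of (i, j, l) \<Rightarrow> \<pi> x * y ^ l * (y - w) ^ (i * t) * poly g y ^ (j * m)) ^ s * poly g y ^ ((D - 1) * m')
         = r x * y ^ (l * s) * (y - w) ^ (i * t * s) * (poly g y ^ (j * m * s) * poly g y ^ ((D - 1) * m'))"
        unfolding x(1) prod.case power_mult_distrib \<pi> power_mult[symmetric] by (simp only: mult.assoc)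
      ultimately show "(case x of (i, j, l) \<Rightarrow> \<pi> x * y ^ l * (y - w) ^ (i * t) * poly g y ^ (j * m)) ^ s * poly g y ^ ((D - 1) * m') = poly (smult (r x) (cp x)) y"
        by (simp add: x(1) cp_def poly_monom mult.commute[of s])
    qed
    also have "\<dots> = poly (\<Sum>x\<in>J. smult (r x) (cp x)) y" by (simp add: poly_sum)
    also have "\<dots> = 0" by (simp only: r(2) poly_0)
    finally show ?thesis using gy spos by simp
  qed
  have degPhi: "degree \<Phi> \<le> A + I * t + (D - 1) * m * B"
    unfolding \<Phi>_def
  proof (rule degree_sum_le)
    fix x assume "x \<in> {..<I} \<times> {..<D}"
    then obtain i j where x: "x = (i, j)" "i < I" "j < D" by auto
    have "degree (trm x) \<le> degree (u i j) + degree ([:-w, 1:] ^ (i * t)) + degree (g ^ (j * m))"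
      unfolding trm_def x by simp (meson add_le_mono degree_mult_le le_refl le_trans)
    also have "\<dots> \<le> A + i * t + j * m * B"
      using degree_power_le[of g "j * m"] deg_u[of i j]
      by (simp add: degree_linear_power B_def mult.commute)
    also have "\<dots> \<le> A + I * t + (D - 1) * m * B"
      using x by (intro add_mono mult_right_mono) auto
    finally show "degree (trm x) \<le> A + I * t + (D - 1) * m * B" .
  qed auto
  have sub: "?Z \<subseteq> {y. poly \<Phi> y = 0}" using zero by blast
  show "finite ?Z" using sub poly_roots_finite[OF \<Phi>0] finite_subset by blast
  have "card ?Z \<le> card {y. poly \<Phi> y = 0}"
    using sub poly_roots_finite[OF \<Phi>0] by (rule card_mono[rotated])
  also have "\<dots> \<le> degree \<Phi>" by (rule card_poly_roots_bound[OF \<Phi>0])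
  finally show "card ?Z \<le> A + I * t + (D - 1) * m * degree g" using degPhi B_def by simp
qed

section \<open>Finite fields inside their algebraic closure\<close>

lemma map_poly_add_hom:
  assumes "\<phi> 0 = 0" "\<And>a b. \<phi> (a + b) = \<phi> a + \<phi> b"
  shows "map_poly \<phi> (p + q) = map_poly \<phi> p + map_poly \<phi> q"
  using assms by (intro poly_eqI) (auto simp: coeff_map_poly)

text \<open>Stated for a general map because it serves both the embedding \<open>to_ac\<close> and
  the Frobenius map on coefficients.\<close>

lemma map_poly_mult_hom:
  fixes \<phi> :: "'b::comm_ring_1 \<Rightarrow> 'c::comm_ring_1"
  assumes "\<phi> 0 = 0" "\<And>a b. \<phi> (a + b) = \<phi> a + \<phi> b" "\<And>a b. \<phi> (a * b) = \<phi> a * \<phi> b"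
  shows "map_poly \<phi> (p * q) = map_poly \<phi> p * map_poly \<phi> q"
proof (rule poly_eqI)
  fix n
  have sum: "\<phi> (sum f A) = (\<Sum>x\<in>A. \<phi> (f x))" if "finite A" for f :: "nat \<Rightarrow> 'b" and A
    using that by (induction A rule: finite_induct) (auto simp: assms)
  show "coeff (map_poly \<phi> (p * q)) n = coeff (map_poly \<phi> p * map_poly \<phi> q) n"
    by (simp add: coeff_map_poly coeff_mult sum assms)
qed

lemma map_poly_prod_hom:
  fixes \<phi> :: "'b::comm_ring_1 \<Rightarrow> 'c::comm_ring_1"
  assumes "\<phi> 0 = 0" "\<phi> 1 = 1" "\<And>a b. \<phi> (a + b) = \<phi> a + \<phi> b" "\<And>a b. \<phi> (a * b) = \<phi> a * \<phi> b"
  shows "map_poly \<phi> (\<Prod>x\<in>A. p x) = (\<Prod>x\<in>A. map_poly \<phi> (p x))"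
  using assms by (induction A rule: infinite_finite_induct) (auto simp: map_poly_mult_hom)

abbreviation ac_poly :: "'a::field poly \<Rightarrow> 'a alg_closure poly"
  where "ac_poly \<equiv> map_poly to_ac"

lemma ac_poly_add [simp]: "ac_poly (p + q) = ac_poly p + ac_poly q"
  by (simp add: map_poly_add_hom)

lemma ac_poly_mult [simp]: "ac_poly (p * q) = ac_poly p * ac_poly q"
  by (simp add: map_poly_mult_hom)

lemma ac_poly_power [simp]: "ac_poly (p ^ n) = ac_poly p ^ n"
  by (induction n) auto

lemma degree_ac_poly [simp]: "degree (ac_poly p) = degree p"
  by (rule degree_map_poly) auto

lemma ac_poly_eq_0_iff [simp]: "ac_poly p = 0 \<longleftrightarrow> p = 0"
  by (simp add: map_poly_eq_0_iff)

lemma coeff_ac_poly [simp]: "coeff (ac_poly p) n = to_ac (coeff p n)"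
  by (simp add: coeff_map_poly)

lemma poly_ac_poly_to_ac: "poly (ac_poly p) (to_ac x) = to_ac (poly p x)"
  by (induction p) (auto simp: map_poly_pCons)

lemma proots_prod_linear: "proots (\<Prod>x\<in>#A. [:-x, 1:]) = (A :: 'a::idom multiset)"
proof (induction A)
  case (add x A)
  have "(\<Prod>x\<in>#A. [:-x, 1:]) \<noteq> 0" by (auto simp: prod_mset_zero_iff)
  then show ?case using add by (simp add: proots_mult del: mult_pCons_left)
qed auto

lemma size_proots_alg_closed:
  fixes p :: "'k::alg_closed_field poly"
  assumes "p \<noteq> 0"
  shows "size (proots p) = degree p" "p = smult (lead_coeff p) (\<Prod>x\<in>#proots p. [:-x, 1:])"
proof -
  obtain A where A: "size A = degree p" "p = smult (lead_coeff p) (\<Prod>x\<in>#A. [:-x, 1:])"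
    using alg_closed_imp_factorization[OF assms(1)] by blast
  have "proots p = A"
    by (subst A(2)) (use assms(1) in \<open>simp add: proots_prod_linear\<close>)
  with A show "size (proots p) = degree p" "p = smult (lead_coeff p) (\<Prod>x\<in>#proots p. [:-x, 1:])"
    by auto
qed

lemma card_poly_roots_eq_degree:
  fixes p :: "'k::alg_closed_field poly"
  assumes "p \<noteq> 0" and simple: "\<And>x. poly p x = 0 \<Longrightarrow> order x p = 1"
  shows "card {x. poly p x = 0} = degree p"
proof -
  have "degree p = size (proots p)" using size_proots_alg_closed[OF assms(1)] by simp
  also have "\<dots> = (\<Sum>x\<in>{x. poly p x = 0}. order x p)"
    using assms(1) by (simp add: size_multiset_overloaded_eq)
  also have "\<dots> = card {x. poly p x = 0}"
    using simple by simp
  finally show ?thesis ..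
qed

lemma order_eq_1_if_pderiv:
  fixes p :: "'k::field poly"
  assumes "poly p x = 0" "poly (pderiv p) x \<noteq> 0"
  shows "order x p = 1"
proof -
  have p0: "p \<noteq> 0" using assms(2) by auto
  have "order x p \<noteq> 0" using assms(1) p0 by (simp add: order_root)
  moreover have "\<not> order x p \<ge> 2"
  proof
    assume "order x p \<ge> 2"
    then have "[:-x, 1:] ^ 2 dvd p" by (simp add: order_divides)
    then obtain q where "p = [:-x, 1:] ^ 2 * q" by (auto simp: dvd_def)
    then have "p = [:-x, 1:] * ([:-x, 1:] * q)" by (simp only: power2_eq_square mult.assoc)
    then have "poly (pderiv p) x = 0"
      by (simp add: pderiv_mult pderiv_pCons del: mult_pCons_left)
    then show False using assms by simp
  qed
  ultimately show ?thesis by linarith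
qed

text \<open>The parameter \<open>T\<close> carries the type of the base field. Writing
  \<open>Q\<close> as a power of the characteristic makes \<open>x \<mapsto> x ^ Q\<close> additive
  on the closure.\<close>

locale finite_field_closure =
  fixes T :: "'a::{finite,field} itself" and Q e :: nat
  assumes Q_def: "Q = card (UNIV :: 'a set)" and Q_eq_CHAR_power: "Q = CHAR('a) ^ e"
begin

lemma prime_CHAR: "prime CHAR('a)"
  using finite_imp_CHAR_pos[where ?'a = 'a] prime_CHAR_semidom by auto

lemma prime_CHAR_ac: "prime CHAR('a alg_closure)"
  using prime_CHAR by simp

lemma Q_gt_1: "Q > 1"
proof -
  have "card {0, 1 :: 'a} \<le> Q" unfolding Q_def by (rule card_mono) auto
  then show ?thesis by simp
qed

lemma e_pos: "e > 0"
  using Q_gt_1 Q_eq_CHAR_power by (cases e) auto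

text \<open>Multiplication by a nonzero \<open>x\<close> permutes the nonzero elements; comparing
  their products gives \<open>x ^ (Q - 1) = 1\<close>.\<close>

lemma power_Q [simp]: "(x :: 'a) ^ Q = x"
proof (cases "x = 0")
  case False
  have "(\<Prod>y\<in>UNIV-{0}. x * y) = (\<Prod>y\<in>UNIV-{0}. y)"
    by (rule prod.reindex_bij_witness[of _ "\<lambda>y. y / x" "\<lambda>y. x * y"]) (use False in auto)
  then have "x ^ (Q - 1) * \<Prod>(UNIV-{0::'a}) = \<Prod>(UNIV-{0})"
    by (simp add: prod.distrib Q_def)
  then have "x ^ (Q - 1) = 1" by simp
  then show ?thesis
    using Q_gt_1 power_Suc[of x "Q - 1"] by simp
qed (use Q_gt_1 in auto)

lemma power_Q_power [simp]: "(x :: 'a) ^ (Q ^ s) = x"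
  by (induction s) (auto simp: power_mult)

lemma Q_power_eq: "Q ^ s = CHAR('a alg_closure) ^ (e * s)"
  by (simp add: Q_eq_CHAR_power power_mult)

lemma frob_add: "(x + y :: 'a alg_closure) ^ (Q ^ s) = x ^ (Q ^ s) + y ^ (Q ^ s)"
  by (rule freshmans_dream'[OF prime_CHAR_ac Q_power_eq])

lemma frob_diff: "(x - y :: 'a alg_closure) ^ (Q ^ s) = x ^ (Q ^ s) - y ^ (Q ^ s)"
  using frob_add[of "x - y" y s] by simp

lemma frob_inj: "(x :: 'a alg_closure) ^ (Q ^ s) = y ^ (Q ^ s) \<longleftrightarrow> x = y"
proof
  assume "x ^ (Q ^ s) = y ^ (Q ^ s)"
  then have "(x - y) ^ (Q ^ s) = 0" by (simp add: frob_diff)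
  then show "x = y" by simp
qed auto

text \<open>For \<open>s > 0\<close> this is the extension of degree \<open>s\<close> of the base
  field; \<open>fixfield 0\<close> is the whole closure.\<close>

definition fixfield :: "nat \<Rightarrow> 'a alg_closure set" where "fixfield s = {x. x ^ (Q ^ s) = x}"

text \<open>The polynomial \<open>X ^ (Q ^ s) - X\<close> has derivative -1, so its roots are simple
  and their number is its degree.\<close>

lemma finite_card_fixfield:
  assumes "s > 0"
  shows "finite (fixfield s)" "card (fixfield s) = Q ^ s"
proof -
  define p :: "'a alg_closure poly" where "p = monom 1 (Q ^ s) - monom 1 1"
  have Qs: "Q ^ s > 1" using Q_gt_1 assms by (intro one_less_power) auto
  have "CHAR('a alg_closure) dvd Q ^ s"
    using Q_power_eq[of s] e_pos assms by simp
  then have z: "of_nat (Q ^ s) = (0 :: 'a alg_closure)"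
    using of_nat_eq_0_iff_char_dvd by blast
  have deg: "degree p = Q ^ s"
  proof -
    have "degree p = degree (monom (1 :: 'a alg_closure) (Q ^ s) + (- monom 1 1))"
      by (simp add: p_def)
    also have "\<dots> = degree (monom (1 :: 'a alg_closure) (Q ^ s))"
      using Qs by (intro degree_add_eq_left) (simp add: degree_monom_eq)
    finally show ?thesis by (simp add: degree_monom_eq)
  qed
  have p0: "p \<noteq> 0"
  proof
    assume "p = 0"
    then have "degree p = 0" by simp
    then show False using deg Q_gt_1 by simp
  qed
  have fixfield: "fixfield s = {x. poly p x = 0}" by (auto simp: fixfield_def p_def poly_monom)
  have "pderiv p = - 1"
    using z by (simp add: p_def pderiv_diff pderiv_monom del: of_nat_power)
  then have "order x p = 1" if "poly p x = 0" for x
    using order_eq_1_if_pderiv[OF that] by simp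
  then show "card (fixfield s) = Q ^ s"
    unfolding fixfield using card_poly_roots_eq_degree[OF p0] deg by simp
  show "finite (fixfield s)" unfolding fixfield by (rule poly_roots_finite[OF p0])
qed

text \<open>One inclusion and equal cardinality \<open>Q\<close>. Membership in the base field thus
  becomes an equation that can be checked by computing with Frobenius.\<close>

lemma range_to_ac_eq: "range to_ac = {x :: 'a alg_closure. x ^ Q = x}"
proof (rule card_subset_eq)
  have F1: "fixfield 1 = {x. x ^ Q = x}" by (simp add: fixfield_def)
  show "finite {x :: 'a alg_closure. x ^ Q = x}" using finite_card_fixfield(1)[of 1] F1 by simp
  show "range to_ac \<subseteq> {x :: 'a alg_closure. x ^ Q = x}"
    by (auto simp flip: to_ac_power)
  show "card (range (to_ac :: 'a \<Rightarrow> _)) = card {x :: 'a alg_closure. x ^ Q = x}"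
    using finite_card_fixfield(2)[of 1] F1 by (simp add: card_image[OF inj_to_ac] Q_def)
qed

lemma poly_ac_poly_frob: "poly (ac_poly (p :: 'a poly)) (x ^ (Q ^ s)) = poly (ac_poly p) x ^ (Q ^ s)"
proof (induction p)
  case (pCons a p)
  have "to_ac a ^ (Q ^ s) = to_ac a" using to_ac_power[of a "Q ^ s"] by simp
  then show ?case using pCons by (simp add: map_poly_pCons frob_add power_mult_distrib)
qed (use Q_gt_1 in auto)

lemma ac_poly_in_fixfield: "x \<in> fixfield s \<Longrightarrow> poly (ac_poly (p :: 'a poly)) x \<in> fixfield s"
  using poly_ac_poly_frob[of p x s] by (simp add: fixfield_def)

text \<open>All Frobenius images of \<open>x\<close> are roots of one polynomial over the base
  field, so two of them coincide; injectivity of Frobenius then brings the coincidence back to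
  \<open>x\<close>.\<close>

lemma ex_in_fixfield: "\<exists>s>0. (x :: 'a alg_closure) \<in> fixfield s"
proof -
  obtain p where p: "p \<noteq> 0" "poly (ac_poly p) x = 0" by (rule alg_closure_algebraic)
  have "(\<lambda>i. x ^ (Q ^ i)) ` UNIV \<subseteq> {y. poly (ac_poly p) y = 0}"
    using p poly_ac_poly_frob[of p x] Q_gt_1 by auto
  then have "finite ((\<lambda>i::nat. x ^ (Q ^ i)) ` UNIV)"
    by (rule finite_subset) (use p in \<open>auto intro: poly_roots_finite\<close>)
  then have "\<not> inj (\<lambda>i::nat. x ^ (Q ^ i))"
    using finite_imageD infinite_UNIV_nat by blast
  then obtain i j :: nat where "i < j" "x ^ (Q ^ i) = x ^ (Q ^ j)"
    by (metis (mono_tags, lifting) injI linorder_neqE_nat)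
  moreover from this have "Q ^ j = Q ^ (j - i) * Q ^ i"
    by (simp flip: power_add)
  ultimately have "x ^ (Q ^ i) = (x ^ (Q ^ (j - i))) ^ (Q ^ i)"
    by (simp only: power_mult)
  then show ?thesis
    using frob_inj[of x i "x ^ (Q ^ (j - i))"] \<open>i < j\<close> by (auto simp: fixfield_def intro!: exI[of _ "j - i"])
qed

lemma map_poly_frob_ac_poly: "map_poly (\<lambda>z. z ^ Q) (ac_poly (p :: 'a poly)) = ac_poly p"
  using Q_gt_1 by (intro poly_eqI) (simp add: coeff_map_poly to_ac_power[symmetric] del: to_ac_power)

lemma frob_hom:
  shows "(0 :: 'a alg_closure) ^ Q = 0" "(x + y :: 'a alg_closure) ^ Q = x ^ Q + y ^ Q"
    "(- x :: 'a alg_closure) ^ Q = - (x ^ Q)"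
  using Q_gt_1 frob_add[of x y 1] frob_diff[of 0 x 1] by auto

text \<open>Frobenius on coefficients fixes \<open>ac_poly p\<close> and carries the factor
  \<open>(X - x) ^ n\<close> to \<open>(X - x ^ Q) ^ n\<close>.\<close>

lemma order_frob_le:
  fixes p :: "'a poly"
  assumes "p \<noteq> 0"
  shows "order x (ac_poly p) \<le> order (x ^ Q) (ac_poly p)"
proof -
  define n where "n = order x (ac_poly p)"
  obtain h where h: "ac_poly p = [:-x, 1:] ^ n * h"
    using order_1[of x "ac_poly p"] by (auto simp: dvd_def n_def)
  have "ac_poly p = map_poly (\<lambda>z. z ^ Q) ([:-x, 1:] ^ n * h)"
    using map_poly_frob_ac_poly[of p] h by simp
  also have "\<dots> = map_poly (\<lambda>z. z ^ Q) ([:-x, 1:] ^ n) * map_poly (\<lambda>z. z ^ Q) h"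
    by (intro map_poly_mult_hom) (simp_all only: frob_hom power_mult_distrib)
  also have "map_poly (\<lambda>z. z ^ Q) ([:-x, 1:] ^ n) = [:- (x ^ Q), 1:] ^ n"
    using map_poly_prod_hom[of "\<lambda>z::'a alg_closure. z ^ Q" "\<lambda>_::nat. [:-x, 1:]" "{..<n}"]
    by (simp add: frob_hom power_mult_distrib map_poly_pCons)
  finally have "[:- (x ^ Q), 1:] ^ n dvd ac_poly p" by simp
  then show ?thesis using assms by (simp add: order_divides n_def)
qed

lemma order_frob_power_le:
  fixes p :: "'a poly"
  assumes "p \<noteq> 0"
  shows "order x (ac_poly p) \<le> order (x ^ (Q ^ i)) (ac_poly p)"
proof (induction i)
  case (Suc i)
  then show ?case
    using order_frob_le[OF assms, of "x ^ (Q ^ i)"] by (simp add: mult.commute flip: power_mult)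
qed auto

text \<open>The order cannot drop along the Frobenius orbit, and \<open>s * i - i\<close> further
  steps lead back to \<open>x\<close>, so it is constant.\<close>

lemma order_frob:
  fixes p :: "'a poly"
  assumes "p \<noteq> 0"
  shows "order (x ^ (Q ^ i)) (ac_poly p) = order x (ac_poly p)"
proof (rule antisym)
  obtain s where s: "s > 0" "x \<in> fixfield s" using ex_in_fixfield by blast
  have per: "x ^ (Q ^ (s * j)) = x" for j
    using s by (induction j) (auto simp: fixfield_def power_add power_mult)
  have "i + (s * i - i) = s * i" using s by simp
  then have "(x ^ (Q ^ i)) ^ (Q ^ (s * i - i)) = x"
    using per[of i] by (metis power_add power_mult)
  then show "order (x ^ (Q ^ i)) (ac_poly p) \<le> order x (ac_poly p)"
    using order_frob_power_le[OF assms, of "x ^ (Q ^ i)" "s * i - i"] by simp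
qed (rule order_frob_power_le[OF assms])

text \<open>Galois descent: Frobenius permutes the linear factors, so it fixes every coefficient,
  and its fixed points are the base field.\<close>

lemma descend_poly:
  fixes S :: "'a alg_closure set"
  assumes "finite S" "(\<lambda>z. z ^ Q) ` S = S"
  shows "\<exists>p. ac_poly p = (\<Prod>y\<in>S. [:-y, 1:])"
proof -
  define P where "P = (\<Prod>y\<in>S. [:-y, 1:])"
  have inj: "inj_on (\<lambda>z::'a alg_closure. z ^ Q) S" using frob_inj[of _ 1] by (auto intro!: inj_onI)
  have "map_poly (\<lambda>z. z ^ Q) P = (\<Prod>y\<in>S. [:- (y ^ Q), 1:])"
    unfolding P_def
    by (subst map_poly_prod_hom)
      (simp_all add: frob_hom power_mult_distrib map_poly_pCons del: power_eq_0_iff)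
  also have "\<dots> = (\<Prod>y\<in>(\<lambda>z. z ^ Q) ` S. [:- y, 1:])"
    by (simp add: prod.reindex[OF inj])
  also have "\<dots> = P" by (simp only: assms P_def)
  finally have "coeff P i ^ Q = coeff P i" for i
    using frob_hom(1) by (metis coeff_map_poly)
  then have "coeff P i \<in> range to_ac" for i
    using range_to_ac_eq by auto
  then have "ac_poly (map_poly of_ac P) = P"
    by (intro poly_eqI) (auto simp: coeff_map_poly to_ac_of_ac)
  then show ?thesis unfolding P_def by blast
qed

end

section \<open>Character sums over the extensions and Stepanov's estimate for them\<close>

locale weil_sum = finite_field_closure T Q e
  for T :: "'a::{finite,field} itself" and Q e :: nat +
  fixes \<chi> :: "'a \<Rightarrow> complex" and g :: "'a poly" and w :: "'a alg_closure"
  assumes chi_0 [simp]: "\<chi> 0 = 0" and chi_1 [simp]: "\<chi> 1 = 1"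
    and chi_mult: "\<chi> (x * y) = \<chi> x * \<chi> y"
    and chi_nontrivial: "\<exists>x. x \<noteq> 0 \<and> \<chi> x \<noteq> 1"
    and g_nz: "g \<noteq> 0" and order_w: "order w (ac_poly g) = 1"
begin

definition G :: "'a alg_closure poly" where "G = ac_poly g"
definition zeros :: "'a alg_closure set" where "zeros = {x. poly G x = 0}"
text \<open>For \<open>x\<close> in the extension of degree \<open>s\<close>, \<open>x ^ repunit s\<close> is its norm to the base field.\<close>
definition repunit :: "nat \<Rightarrow> nat" where "repunit s = (\<Sum>i<s. Q ^ i)"
text \<open>Meaningful only on \<open>range to_ac\<close>, the copy of the base field; hence the
  membership lemmas and hypotheses below.\<close>

definition chi_ac :: "'a alg_closure \<Rightarrow> complex" where "chi_ac x = \<chi> (of_ac x)"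
text \<open>The sum \<open>S\<^sub>s\<close>: the character composed with the norm from the
  extension of degree \<open>s\<close>.\<close>

definition char_sum :: "nat \<Rightarrow> complex" where "char_sum s = (\<Sum>y\<in>fixfield s. chi_ac (poly G y ^ repunit s))"
definition \<rho> :: real where "\<rho> = sqrt (real Q)"

lemma chi_power: "\<chi> (x ^ n) = \<chi> x ^ n"
  by (induction n) (auto simp: chi_mult)

lemma norm_chi: "x \<noteq> 0 \<Longrightarrow> norm (\<chi> x) = 1"
proof -
  assume "x \<noteq> 0"
  then have "x ^ (Q - 1) = 1"
    using power_Suc[of x "Q - 1"] Q_gt_1 by simp
  then have "\<chi> x ^ (Q - 1) = 1" using chi_power[of x "Q - 1"] by simp
  then have "norm (\<chi> x) ^ (Q - 1) = 1" by (metis norm_one norm_power)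
  then show ?thesis using Q_gt_1 power_eq_imp_eq_base[of "norm (\<chi> x)" "Q - 1" 1] by simp
qed

lemma norm_chi_le: "norm (\<chi> x) \<le> 1"
  using norm_chi[of x] by (cases "x = 0") auto

lemma sum_chi: "(\<Sum>c\<in>UNIV. \<chi> c) = 0"
proof -
  obtain x where x: "x \<noteq> 0" "\<chi> x \<noteq> 1" using chi_nontrivial by blast
  have "(\<Sum>c\<in>UNIV. \<chi> c) = (\<Sum>c\<in>UNIV. \<chi> (x * c))"
    by (rule sum.reindex_bij_witness[of _ "\<lambda>c. x * c" "\<lambda>c. c / x"]) (use x in auto)
  also have "\<dots> = \<chi> x * (\<Sum>c\<in>UNIV. \<chi> c)" by (simp add: chi_mult sum_distrib_left)
  finally show ?thesis using x by simp
qed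

lemma repunit_add: "repunit (a + b) = repunit a + Q ^ a * repunit b"
  by (induction b) (auto simp: repunit_def algebra_simps power_add)

lemma repunit_eq: "(Q - 1) * repunit s + 1 = Q ^ s"
proof (induction s)
  case (Suc s)
  have "(Q - 1) * repunit (Suc s) + 1 = ((Q - 1) * repunit s + 1) + (Q - 1) * Q ^ s"
    by (simp add: repunit_def algebra_simps)
  also have "\<dots> = Q ^ s + (Q - 1) * Q ^ s" by (simp only: Suc)
  also have "\<dots> = Q ^ Suc s" using Q_gt_1 by (cases Q) auto
  finally show ?case .
qed (auto simp: repunit_def)

lemma repunit_pos: "s > 0 \<Longrightarrow> repunit s > 0"
  unfolding repunit_def using Q_gt_1 by (intro sum_pos) auto

lemma G_nz: "G \<noteq> 0" using g_nz by (simp add: G_def)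

lemma finite_zeros: "finite zeros" using poly_roots_finite[OF G_nz] by (simp add: zeros_def)

text \<open>Norms lie in the base field: raising the product of all conjugates to the power
  \<open>Q\<close> only shifts the factors cyclically.\<close>

lemma power_repunit_in_range:
  assumes "x \<in> fixfield s"
  shows "x ^ repunit s \<in> range to_ac"
proof -
  have "repunit s * Q + 1 = repunit s + Q ^ s"
    using repunit_eq[of s] Q_gt_1 by (cases Q) (auto simp: algebra_simps)
  then have "x * (x ^ repunit s) ^ Q = x ^ repunit s * x ^ (Q ^ s)"
    by (metis power_Suc power_add power_mult Suc_eq_plus1)
  then have "x * ((x ^ repunit s) ^ Q - x ^ repunit s) = 0"
    using assms by (simp add: fixfield_def algebra_simps)
  then show ?thesis
    using frob_hom(1) by (cases "x = 0"; cases "repunit s = 0") (auto simp: range_to_ac_eq power_0_left)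
qed

definition fibre_card :: "nat \<Rightarrow> 'a \<Rightarrow> nat" where
  "fibre_card s c = card {y \<in> fixfield s. of_ac (poly G y ^ repunit s) = c}"

lemma char_sum_eq:
  assumes "s > 0"
  shows "char_sum s = (\<Sum>c\<in>UNIV. \<chi> c * fibre_card s c)"
proof -
  have "char_sum s = (\<Sum>c\<in>UNIV. \<Sum>y\<in>{y \<in> fixfield s. of_ac (poly G y ^ repunit s) = c}. chi_ac (poly G y ^ repunit s))"
    unfolding char_sum_def by (rule sum.group[symmetric]) (use finite_card_fixfield(1)[OF assms] in auto)
  also have "\<dots> = (\<Sum>c\<in>UNIV. \<Sum>y\<in>{y \<in> fixfield s. of_ac (poly G y ^ repunit s) = c}. \<chi> c)"
    by (intro sum.cong refl) (auto simp: chi_ac_def)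
  finally show ?thesis by (simp add: fibre_card_def mult.commute)
qed

lemma sum_fibre_card:
  assumes "s > 0"
  shows "(\<Sum>c\<in>UNIV. fibre_card s c) = Q ^ s"
proof -
  have "card (fixfield s) = (\<Sum>c\<in>UNIV. card {y \<in> fixfield s. of_ac (poly G y ^ repunit s) = c})"
    using sum.group[of "fixfield s" UNIV "\<lambda>y. of_ac (poly G y ^ repunit s)" "\<lambda>_. 1::nat"] finite_card_fixfield(1)[OF assms] by simp
  then show ?thesis by (simp add: fibre_card_def finite_card_fixfield(2)[OF assms])
qed

lemma fibre_card_0:
  assumes "s > 0"
  shows "fibre_card s 0 \<le> card zeros"
  unfolding fibre_card_def
proof (rule card_mono[OF finite_zeros], clarify)
  fix y assume y: "y \<in> fixfield s" "of_ac (poly G y ^ repunit s) = 0"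
  have "poly G y ^ repunit s \<in> range to_ac"
    using y by (intro power_repunit_in_range) (auto simp: G_def intro: ac_poly_in_fixfield)
  then have "poly G y ^ repunit s = 0" using y(2) to_ac_of_ac by fastforce
  then show "y \<in> zeros" by (simp add: zeros_def)
qed

text \<open>Collects the coefficients of \<open>t\<close> at the end of
  \<open>fibre_card_bound\<close>; it does not depend on \<open>s\<close>.\<close>

definition stepanov_const :: real where "stepanov_const = 5 + 3 * (real Q - 1) * degree G + (real Q - 1)"

text \<open>An instance of \<open>stepanov_bound\<close>: \<open>Q ^ s\<close> is split as
  \<open>t * s'\<close> into nearly equal powers of \<open>Q\<close>, with \<open>D = Q - 1\<close>
  and \<open>A = m\<close>. Then \<open>m * s' + m'\<close> equals \<open>repunit s\<close>, so the
  counted set is a fibre of the norm.\<close>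

lemma fibre_card_bound:
  assumes s: "s \<ge> 3" and c: "c \<noteq> 0"
  shows "(real Q - 1) * fibre_card s c \<le> real Q ^ s + stepanov_const * \<rho> ^ (s + 1)"
proof -
  define a where "a = s div 2"
  define b where "b = s - a"
  define t where "t = Q ^ b"
  define s' where "s' = Q ^ a"
  define B where "B = degree G"
  define D where "D = Q - 1"
  define m where "m = repunit b"
  define m' where "m' = repunit a"
  have ab: "a + b = s" "b \<ge> 2" "a \<le> b" "2 * b \<le> s + 1" using s by (auto simp: a_def b_def)
  have D: "real D = real Q - 1" "D > 0" using Q_gt_1 by (auto simp: D_def)
  have tm: "t = D * m + 1" "s' = D * m' + 1"
    using repunit_eq[of a] repunit_eq[of b] by (auto simp: t_def s'_def D_def m_def m'_def)
  have m: "m > 0" using repunit_pos[of b] ab by (simp add: m_def)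
  have s't: "s' \<le> t" unfolding s'_def t_def using ab Q_gt_1 by (intro power_increasing) auto
  have "2 ^ 2 \<le> Q ^ 2" using Q_gt_1 by (intro power_mono) auto
  also have "\<dots> \<le> t" unfolding t_def using ab Q_gt_1 by (intro power_increasing) auto
  finally have t4: "t \<ge> 4" by simp
  \<comment> \<open>As \<open>D * m = t - 1\<close> and \<open>(D - 1) * m' \<le> s'\<close>, the
    unknowns outnumber the equations once \<open>s' * (m + B) < (t - 2) * I\<close>; this is the
    least such \<open>I\<close>.\<close>
  define I where "I = s' * (m + B) div (t - 2) + 1"
  have I1: "s' * (m + B) < (t - 2) * I"
    using dividend_less_div_times[of "t - 2" "s' * (m + B)"] t4 by (simp add: I_def algebra_simps)
  have I2: "(t - 2) * I \<le> s' * (m + B) + (t - 2)"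
    unfolding I_def add_mult_distrib2 by (intro add_mono) auto
  have "(D - 1) * m' \<le> s'" using tm(2) D(2) by (cases D) auto
  then have "s' * m + I + (D - 1) * m' * B \<le> s' * m + I + s' * B"
    by (intro add_mono mult_right_mono) auto
  also have "\<dots> < (t - 2) * I + I" using I1 by (simp add: algebra_simps)
  also have "\<dots> = (t - 2 + 1) * I" by (simp add: algebra_simps)
  also have "t - 2 + 1 = D * m" using tm(1) t4 by simp
  finally have unk: "s' * m + I + (D - 1) * m' * degree G < D * m * I" by (simp add: B_def)
  have tt: "t * s' = Q ^ s" "m * s' + m' = repunit s"
    using ab repunit_add[of a b] by (auto simp: t_def s'_def m_def m'_def mult.commute add.commute simp flip: power_add)
  have eqset: "{y \<in> fixfield s. of_ac (poly G y ^ repunit s) = c} = {y. y ^ (t * s') = y \<and> poly G y ^ (m * s' + m') = to_ac c}"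
  proof -
    have "of_ac (poly G y ^ repunit s) = c \<longleftrightarrow> poly G y ^ repunit s = to_ac c" if "y \<in> fixfield s" for y
    proof -
      have "poly G y ^ repunit s \<in> range to_ac"
        using that by (intro power_repunit_in_range) (auto simp: G_def intro: ac_poly_in_fixfield)
      then show ?thesis using to_ac_of_ac by fastforce
    qed
    then show ?thesis unfolding tt fixfield_def by blast
  qed
  have "fibre_card s c \<le> m + I * t + (D - 1) * m * degree G"
    unfolding fibre_card_def eqset
    by (rule stepanov_bound(2)[OF prime_CHAR_ac _ _ tm m G_nz _ order.refl _ unk, where w = w])
      (use c order_w in \<open>auto simp: s'_def t_def Q_power_eq G_def\<close>)
  also have "(D - 1) * m \<le> t" using tm(1) D(2) by (cases D) auto
  finally have "fibre_card s c \<le> m + I * t + t * B" by (simp add: B_def mult_right_mono)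
  then have N1: "real (fibre_card s c) \<le> m + real I * t + t * B"
    by (metis of_nat_le_iff of_nat_add of_nat_mult)
  have rt: "real t - 2 > 0" "real t \<ge> 4" using t4 by auto
  have I2r: "(real t - 2) * I \<le> real s' * (m + B) + (real t - 2)"
  proof -
    have "real ((t - 2) * I) \<le> real (s' * (m + B) + (t - 2))" using I2 by (simp only: of_nat_le_iff)
    then show ?thesis using t4 by (simp add: of_nat_diff)
  qed
  have tIr: "real t * I \<le> real s' * (m + B) + t + 4 * (m + B)"
  proof -
    have "real I * 2 \<le> 4 * (real m + B) + 2"
    proof -
      have "real s' * (m + B) \<le> real t * (m + B)" using s't by (intro mult_right_mono) auto
      also have "\<dots> \<le> 2 * (real t - 2) * (m + B)" using rt by (intro mult_right_mono) auto
      finally have "(real t - 2) * I \<le> (real t - 2) * (2 * (m + B) + 1)"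
        using I2r by (simp add: algebra_simps)
      then have "real I \<le> 2 * (m + B) + 1" using rt by (simp only: mult_le_cancel_left_pos)
      then show ?thesis by simp
    qed
    then show ?thesis using I2r by (simp add: algebra_simps)
  qed
  have Dm: "real D * m \<le> t" "real D * s' * m \<le> real Q ^ s"
  proof -
    have "D * m \<le> t" using tm(1) by simp
    then show 1: "real D * m \<le> t" by (metis of_nat_le_iff of_nat_mult)
    have "real s' * (real D * m) \<le> real s' * t" using 1 by (intro mult_left_mono) auto
    also have "\<dots> = real (t * s')" by simp
    also have "\<dots> = real Q ^ s" by (simp only: tt of_nat_power)
    finally show "real D * s' * m \<le> real Q ^ s" by (simp add: mult_ac)
  qed
  have "real D * real (fibre_card s c) \<le> real D * (m + (real s' * (m + B) + t + 4 * (m + B)) + t * B)"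
    using N1 tIr by (intro mult_left_mono) (auto simp: mult.commute)
  also have "\<dots> = real D * s' * m + 5 * (real D * m) + real D * s' * B + real D * t + real D * B * 4 + real D * t * B"
    by (simp add: algebra_simps)
  also have "\<dots> \<le> real Q ^ s + 5 * t + real D * t * B + real D * t + real D * B * t + real D * t * B"
    using Dm s't rt by (intro add_mono mult_mono mult_left_mono mult_nonneg_nonneg) auto
  also have "\<dots> = real Q ^ s + stepanov_const * t"
  proof -
    have "real Q = real D + 1" using D by simp
    then show ?thesis by (simp add: stepanov_const_def B_def algebra_simps)
  qed
  also have "\<dots> \<le> real Q ^ s + stepanov_const * \<rho> ^ (s + 1)"
  proof -
    have "real t = \<rho> ^ (2 * b)" by (simp add: t_def \<rho>_def power_mult)
    also have "\<dots> \<le> \<rho> ^ (s + 1)" using ab Q_gt_1 by (intro power_increasing) (auto simp: \<rho>_def)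
    finally show ?thesis using Q_gt_1 by (intro add_left_mono mult_left_mono) (auto simp: stepanov_const_def)
  qed
  finally show ?thesis by (simp add: D)
qed

lemma rho: "\<rho> > 1" "\<rho> ^ 2 = Q"
  using Q_gt_1 by (auto simp: \<rho>_def)

text \<open>The counts over nonzero \<open>c\<close> are only bounded from above. Since the values
  of \<chi> sum to 0, their common bound \<open>u\<close> may be subtracted from each; the defects
  \<open>u - fibre_card s c\<close> are nonnegative, and their total is small because all counts add
  up to \<open>Q ^ s\<close>.\<close>

lemma char_sum_bound_large:
  assumes s: "s \<ge> 3"
  shows "norm (char_sum s) \<le> stepanov_const * \<rho> ^ (s + 1) + card zeros"
proof -
  define u where "u = (real Q ^ s + stepanov_const * \<rho> ^ (s + 1)) / (real Q - 1)"
  have Q1: "real Q - 1 > 0" using Q_gt_1 by simp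
  have u: "real (fibre_card s c) \<le> u" if "c \<noteq> 0" for c
    using fibre_card_bound[OF s that] Q1 by (simp add: u_def field_simps)
  have "char_sum s = (\<Sum>c\<in>UNIV. \<chi> c * fibre_card s c) - of_real u * (\<Sum>c\<in>UNIV. \<chi> c)"
    using char_sum_eq s by (simp add: sum_chi)
  also have "\<dots> = (\<Sum>c\<in>UNIV. \<chi> c * of_real (real (fibre_card s c) - u))"
    by (simp add: sum_distrib_left sum_subtractf[symmetric] algebra_simps)
  also have "\<dots> = (\<Sum>c\<in>UNIV - {0}. \<chi> c * of_real (real (fibre_card s c) - u))"
    by (rule sum.mono_neutral_right) auto
  finally have "norm (char_sum s) \<le> (\<Sum>c\<in>UNIV - {0}. norm (\<chi> c * of_real (real (fibre_card s c) - u)))"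
    by (simp only: norm_sum)
  also have "\<dots> = (\<Sum>c\<in>UNIV - {0}. u - real (fibre_card s c))"
    using u by (intro sum.cong) (auto simp: norm_mult norm_chi simp flip: of_real_diff)
  also have "\<dots> = (real Q - 1) * u - (\<Sum>c\<in>UNIV - {0}. real (fibre_card s c))"
    using Q_gt_1 by (simp add: sum_subtractf card_Diff_singleton Q_def[symmetric])
  also have "(\<Sum>c\<in>UNIV - {0}. real (fibre_card s c)) = real Q ^ s - fibre_card s 0"
  proof -
    have "(\<Sum>c\<in>UNIV. real (fibre_card s c)) = real (Q ^ s)"
      using sum_fibre_card[of s] s by (metis of_nat_sum not_gr_zero not_numeral_le_zero)
    then show ?thesis by (simp add: sum.remove[of UNIV 0])
  qed
  also have "(real Q - 1) * u = real Q ^ s + stepanov_const * \<rho> ^ (s + 1)" using Q1 by (simp add: u_def)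
  finally show ?thesis using fibre_card_0[of s] s by simp
qed

lemma char_sum_trivial: "s > 0 \<Longrightarrow> norm (char_sum s) \<le> real Q ^ s"
proof -
  assume s: "s > 0"
  have "norm (char_sum s) \<le> (\<Sum>y\<in>fixfield s. 1)" unfolding char_sum_def
    by (intro sum_norm_le) (auto simp: chi_ac_def norm_chi_le)
  then show ?thesis by (simp add: finite_card_fixfield(2)[OF s])
qed

lemma char_sum_bound: "\<exists>C. \<forall>s>0. norm (char_sum s) \<le> C * \<rho> ^ s"
proof (intro exI allI impI)
  fix s :: nat assume s: "s > 0"
  let ?C = "stepanov_const * \<rho> + card zeros + \<rho> ^ 2"
  have stepanov_const: "stepanov_const \<ge> 0" using Q_gt_1 by (auto simp: stepanov_const_def)
  have rs: "\<rho> ^ s \<ge> 1" using rho by simp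
  show "norm (char_sum s) \<le> ?C * \<rho> ^ s"
  proof (cases "s \<ge> 3")
    case True
    have "norm (char_sum s) \<le> stepanov_const * \<rho> * \<rho> ^ s + card zeros * 1" using char_sum_bound_large[OF True] by simp
    also have "\<dots> \<le> stepanov_const * \<rho> * \<rho> ^ s + card zeros * \<rho> ^ s + \<rho> ^ 2 * \<rho> ^ s"
      using rho(1) mult_left_mono[OF rs, of "real (card zeros)"] by (simp add: add_increasing2)
    finally show ?thesis by (simp add: algebra_simps)
  next
    case False
    have "norm (char_sum s) \<le> \<rho> ^ s * \<rho> ^ s"
      using char_sum_trivial[OF s] by (simp add: rho(2)[symmetric] power2_eq_square power_mult_distrib)
    also have "\<dots> \<le> \<rho> ^ 2 * \<rho> ^ s"
      using rs rho False by (intro mult_right_mono power_increasing) auto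
    also have "\<dots> \<le> ?C * \<rho> ^ s" using stepanov_const rs rho by (intro mult_right_mono) auto
    finally show ?thesis .
  qed
qed

end

section \<open>Newton's identities for sums over monic polynomials\<close>

lemma prod_mset_power_const: "(\<Prod>x\<in>#M. f x ^ n) = (\<Prod>x\<in>#M. f x :: 'a::comm_monoid_mult) ^ n"
  by (induction M) (auto simp: power_mult_distrib)

lemma sum_Sigma3:
  assumes "finite A" "\<And>x. x \<in> A \<Longrightarrow> finite (B x)" "\<And>x y. x \<in> A \<Longrightarrow> y \<in> B x \<Longrightarrow> finite (C x y)"
  shows "(\<Sum>x\<in>A. \<Sum>y\<in>B x. \<Sum>z\<in>C x y. f x y z) = (\<Sum>(x, y, z)\<in>(SIGMA x:A. SIGMA y:B x. C x y). f x y z)"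
proof -
  have "(\<Sum>x\<in>A. \<Sum>y\<in>B x. \<Sum>z\<in>C x y. f x y z) = (\<Sum>x\<in>A. \<Sum>(y, z)\<in>Sigma (B x) (C x). f x y z)"
    using assms by (intro sum.cong refl sum.Sigma) auto
  also have "\<dots> = (\<Sum>(x, y, z)\<in>(SIGMA x:A. SIGMA y:B x. C x y). f x y z)"
    using assms by (subst sum.Sigma) auto
  finally show ?thesis .
qed

section \<open>Conjugates, minimal polynomials and monic polynomials over the base field\<close>

context finite_field_closure
begin

definition conj_degree :: "'a alg_closure \<Rightarrow> nat" where "conj_degree x = (LEAST s. s > 0 \<and> x \<in> fixfield s)"

definition conjugates :: "'a alg_closure \<Rightarrow> 'a alg_closure set" where
  "conjugates x = (\<lambda>i. x ^ (Q ^ i)) ` {..<conj_degree x}"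

lemma conj_degree: "conj_degree x > 0" "x \<in> fixfield (conj_degree x)"
  using LeastI_ex[OF ex_in_fixfield[of x]] by (auto simp: conj_degree_def)

lemma not_in_fixfield: "0 < s \<Longrightarrow> s < conj_degree x \<Longrightarrow> x \<notin> fixfield s"
  using not_less_Least[of s "\<lambda>s. s > 0 \<and> x \<in> fixfield s"] by (auto simp: conj_degree_def)

lemma frob_power_mod: "x ^ (Q ^ i) = x ^ (Q ^ (i mod conj_degree x))"
proof -
  have per: "x ^ (Q ^ (conj_degree x * j)) = x" for j
    using conj_degree(2)[of x] by (induction j) (auto simp: fixfield_def power_add power_mult)
  have "x ^ (Q ^ i) = x ^ (Q ^ (conj_degree x * (i div conj_degree x) + i mod conj_degree x))" by simp
  also have "\<dots> = (x ^ (Q ^ (conj_degree x * (i div conj_degree x)))) ^ (Q ^ (i mod conj_degree x))"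
    by (simp only: power_add power_mult)
  finally show ?thesis by (simp only: per)
qed

lemma in_fixfield_iff: "x \<in> fixfield s \<longleftrightarrow> conj_degree x dvd s"
proof
  assume "x \<in> fixfield s"
  then have "x \<in> fixfield (s mod conj_degree x)" using frob_power_mod[of x s] by (simp add: fixfield_def)
  then show "conj_degree x dvd s" using not_in_fixfield[of "s mod conj_degree x" x] conj_degree(1)[of x] by (auto simp: mod_eq_0_iff_dvd)
next
  assume "conj_degree x dvd s"
  then show "x \<in> fixfield s" using frob_power_mod[of x s] by (simp add: fixfield_def)
qed

lemma inj_conjugates: "inj_on (\<lambda>i. x ^ (Q ^ i)) {..<conj_degree x}"
proof (rule linorder_inj_onI')
  fix i j assume ij: "i \<in> {..<conj_degree x}" "j \<in> {..<conj_degree x}" "i < j"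
  show "x ^ (Q ^ i) \<noteq> x ^ (Q ^ j)"
  proof
    assume eq: "x ^ (Q ^ i) = x ^ (Q ^ j)"
    have "Q ^ j = Q ^ (j - i) * Q ^ i" using ij by (simp flip: power_add)
    then have "x ^ (Q ^ i) = (x ^ (Q ^ (j - i))) ^ (Q ^ i)"
      using eq by (simp only: power_mult)
    then have "x \<in> fixfield (j - i)"
      using frob_inj[of x i "x ^ (Q ^ (j - i))"] by (simp add: fixfield_def)
    then show False using not_in_fixfield[of "j - i" x] ij by (simp add: less_imp_diff_less)
  qed
qed

lemma conjugates: "finite (conjugates x)" "card (conjugates x) = conj_degree x" "x \<in> conjugates x"
  using conj_degree(1)[of x] by (auto simp: conjugates_def card_image[OF inj_conjugates] intro: image_eqI[of _ _ 0])

lemma frob_conjugates: "(\<lambda>z. z ^ Q) ` conjugates x = conjugates x"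
proof (rule card_subset_eq)
  show "(\<lambda>z. z ^ Q) ` conjugates x \<subseteq> conjugates x"
  proof clarify
    fix z assume "z \<in> conjugates x"
    then obtain i where "z = x ^ (Q ^ i)" by (auto simp: conjugates_def)
    then have "z ^ Q = x ^ (Q ^ Suc i)" by (simp add: mult.commute flip: power_mult)
    also have "\<dots> = x ^ (Q ^ (Suc i mod conj_degree x))" by (rule frob_power_mod)
    finally show "z ^ Q \<in> conjugates x" using conj_degree(1)[of x] by (auto simp: conjugates_def)
  qed
  have "inj_on (\<lambda>z. z ^ Q) (conjugates x)" using frob_inj[of _ 1] by (auto intro!: inj_onI)
  then show "card ((\<lambda>z. z ^ Q) ` conjugates x) = card (conjugates x)" by (rule card_image)
qed (rule conjugates)

definition min_poly :: "'a alg_closure \<Rightarrow> 'a poly" where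
  "min_poly x = (SOME p. ac_poly p = (\<Prod>y\<in>conjugates x. [:-y, 1:]))"

lemma min_poly: "ac_poly (min_poly x) = (\<Prod>y\<in>conjugates x. [:-y, 1:])"
  unfolding min_poly_def by (rule someI_ex[OF descend_poly[OF conjugates(1) frob_conjugates]])

lemma degree_min_poly: "degree (min_poly x) = conj_degree x"
proof -
  have "degree (min_poly x) = degree (ac_poly (min_poly x))" by simp
  also have "\<dots> = (\<Sum>y\<in>conjugates x. degree [:-y, 1:])"
    unfolding min_poly by (rule degree_prod_eq_sum_degree) auto
  finally show ?thesis by (simp add: conjugates)
qed

lemma lead_coeff_min_poly: "lead_coeff (min_poly x) = 1"
proof -
  have "to_ac (lead_coeff (min_poly x)) = lead_coeff (\<Prod>y\<in>conjugates x. [:-y, 1:])"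
    by (simp flip: min_poly)
  also have "\<dots> = 1" by (simp add: lead_coeff_prod)
  finally show ?thesis by simp
qed

lemma min_poly_nz: "min_poly x \<noteq> 0" using lead_coeff_min_poly[of x] by auto

lemma order_min_poly: "order x (ac_poly (min_poly x)) = 1"
proof -
  have "ac_poly (min_poly x) = [:-x, 1:] * (\<Prod>y\<in>conjugates x - {x}. [:-y, 1:])"
    unfolding min_poly by (rule prod.remove) (auto simp: conjugates)
  moreover have "poly (\<Prod>y\<in>conjugates x - {x}. [:-y, 1:]) x \<noteq> 0"
    using conjugates by (auto simp: poly_prod)
  moreover have "order x [:-x, 1:] = 1" using order_power_n_n[of x 1] by simp
  ultimately show ?thesis
    by (simp add: order_mult order_0I del: mult_pCons_left) (metis min_poly_nz ac_poly_eq_0_iff no_zero_divisors order_0I order_mult One_nat_def add.right_neutral)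
qed

text \<open>The remainder modulo \<open>min_poly x\<close> vanishes at all
  \<open>conj_degree x\<close> conjugates but has smaller degree.\<close>

lemma min_poly_dvd:
  assumes "poly (ac_poly p) x = 0"
  shows "min_poly x dvd p"
proof -
  define r where "r = p mod min_poly x"
  have "p = min_poly x * (p div min_poly x) + r" by (simp add: r_def)
  then have "poly (ac_poly p) y = poly (ac_poly (min_poly x)) y * poly (ac_poly (p div min_poly x)) y + poly (ac_poly r) y" for y
    by (metis ac_poly_add ac_poly_mult poly_add poly_mult)
  moreover have "poly (ac_poly (min_poly x)) x = 0"
    using conjugates by (auto simp: min_poly poly_prod)
  ultimately have rx: "poly (ac_poly r) x = 0" using assms by auto
  have "r = 0"
  proof (rule ccontr)
    assume r0: "r \<noteq> 0"
    have "conjugates x \<subseteq> {y. poly (ac_poly r) y = 0}"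
      using rx Q_gt_1 by (auto simp: conjugates_def poly_ac_poly_frob)
    then have "card (conjugates x) \<le> card {y. poly (ac_poly r) y = 0}"
      using r0 by (intro card_mono poly_roots_finite) auto
    also have "\<dots> \<le> degree r" using card_poly_roots_bound[of "ac_poly r"] r0 by simp
    also have "\<dots> < degree (min_poly x)"
      using r0 degree_mod_less'[of "min_poly x" p] min_poly_nz[of x] by (auto simp: r_def)
    finally show False by (simp add: conjugates degree_min_poly)
  qed
  then show ?thesis by (simp add: r_def mod_eq_0_iff_dvd)
qed

lemma min_poly_power_dvd:
  assumes "p \<noteq> 0" "j \<le> order x (ac_poly p)"
  shows "min_poly x ^ j dvd p"
  using assms
proof (induction j arbitrary: p)
  case (Suc j)
  then have "poly (ac_poly p) x = 0" by (simp add: order_root)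
  then obtain h where h: "p = min_poly x * h" using min_poly_dvd by (auto simp: dvd_def)
  then have "order x (ac_poly p) = 1 + order x (ac_poly h)"
    using Suc.prems by (simp add: order_mult order_min_poly)
  then have "min_poly x ^ j dvd h" using Suc h by auto
  then show ?case by (simp add: h)
qed auto

definition monics :: "nat \<Rightarrow> 'a poly set" where "monics m = {p. degree p = m \<and> lead_coeff p = 1}"

lemma finite_monics: "finite (monics m)"
proof (rule finite_subset)
  show "monics m \<subseteq> Poly ` {xs. set xs \<subseteq> UNIV \<and> length xs = Suc m}"
  proof
    fix p assume "p \<in> monics m"
    then have "p = Poly (coeffs p)" "length (coeffs p) = Suc m"
      by (auto simp: monics_def intro!: length_coeffs_degree)
    then show "p \<in> Poly ` {xs. set xs \<subseteq> UNIV \<and> length xs = Suc m}" by blast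
  qed
  show "finite (Poly ` {xs :: 'a list. set xs \<subseteq> UNIV \<and> length xs = Suc m})"
    by (intro finite_imageI finite_lists_length_eq) auto
qed

lemma monicsD:
  assumes "p \<in> monics m"
  shows "p \<noteq> 0" "degree p = m" "lead_coeff p = 1"
  using assms by (auto simp: monics_def)

lemma monics_0: "monics 0 = {1}"
proof -
  have "p = 1" if p: "p \<in> monics 0" for p
  proof -
    obtain c where "p = [:c:]" using monicsD(2)[OF p] by (rule degree_eq_zeroE)
    then show ?thesis using monicsD(3)[OF p] by (simp add: one_pCons)
  qed
  then show ?thesis by (auto simp: monics_def)
qed

lemma monics_mult:
  assumes "p \<in> monics m" "q \<in> monics n"
  shows "p * q \<in> monics (m + n)"
proof -
  have "degree (p * q) = m + n"
    using monicsD(1,2)[OF assms(1)] monicsD(1,2)[OF assms(2)] by (simp add: degree_mult_eq)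
  moreover have "lead_coeff (p * q) = 1"
    unfolding lead_coeff_mult monicsD(3)[OF assms(1)] monicsD(3)[OF assms(2)] by simp
  ultimately show ?thesis by (simp only: monics_def mem_Collect_eq)
qed

lemma monics_dvd:
  assumes "p * q \<in> monics m" "p \<in> monics n"
  shows "n \<le> m" "q \<in> monics (m - n)"
proof -
  have nz: "p \<noteq> 0" "q \<noteq> 0" using monicsD(1)[OF assms(1)] by auto
  have "degree p + degree q = m" using monicsD(2)[OF assms(1)] degree_mult_eq[OF nz] by simp
  moreover have "lead_coeff q = 1"
    using monicsD(3)[OF assms(1)] monicsD(3)[OF assms(2)] unfolding lead_coeff_mult by simp
  ultimately show "n \<le> m" "q \<in> monics (m - n)"
    using monicsD(2)[OF assms(2)] by (auto simp: monics_def)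
qed

lemma min_poly_power_in_monics: "min_poly x ^ j \<in> monics (conj_degree x * j)"
proof (induction j)
  case (Suc j)
  have "min_poly x \<in> monics (conj_degree x)" using lead_coeff_min_poly degree_min_poly by (simp add: monics_def)
  from monics_mult[OF this Suc] show ?case by simp
qed (simp add: monics_0)

end

section \<open>The character on monic polynomials and its power sums\<close>

context weil_sum
begin

text \<open>
  For monic \<open>p\<close> of degree \<open>m\<close>, \<open>lead_sign ^ m * res p\<close> is the product of the values of \<open>G\<close> at the roots of
  \<open>p\<close>; but \<open>res p\<close> visibly depends only on the values of \<open>p\<close> at the roots of \<open>G\<close>.
\<close>
definition res :: "'a poly \<Rightarrow> 'a alg_closure" where
  "res p = (\<Prod>w\<in>#proots G. poly (ac_poly p) w)"

definition lead_sign :: "'a alg_closure" where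
  "lead_sign = lead_coeff G * (- 1) ^ size (proots G)"

text \<open>Frobenius is a bijection of the closure and \<open>order\<close> is constant on its
  orbits, so it permutes the roots with their multiplicities.\<close>

lemma frob_proots: "image_mset (\<lambda>z. z ^ Q) (proots G) = proots G"
proof (rule multiset_eqI)
  fix y :: "'a alg_closure"
  have inj: "inj (\<lambda>z :: 'a alg_closure. z ^ Q)" using frob_inj[of _ 1] by (auto intro!: injI)
  obtain s where s: "s > 0" "y \<in> fixfield s" using ex_in_fixfield by blast
  define x where "x = y ^ (Q ^ (s - 1))"
  have "x ^ Q = y ^ (Q ^ Suc (s - 1))" by (simp add: x_def mult.commute flip: power_mult)
  then have y: "y = x ^ Q" using s by (simp add: fixfield_def)
  have "(\<lambda>z. z ^ Q) -` {x ^ Q} = {x}" using inj by (auto dest: injD)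
  then have "count (image_mset (\<lambda>z. z ^ Q) (proots G)) (x ^ Q) = count (proots G) x"
    using G_nz by (simp add: count_image_mset order_root Int_insert_left)
  also have "\<dots> = count (proots G) (x ^ Q)"
    using order_frob[OF g_nz, of x 1] G_nz by (simp add: G_def)
  finally show "count (image_mset (\<lambda>z. z ^ Q) (proots G)) y = count (proots G) y" by (simp add: y)
qed

lemma res_in_range: "res p \<in> range to_ac"
proof -
  have frob1: "poly (ac_poly p) w ^ Q = poly (ac_poly p) (w ^ Q)" for w
    using poly_ac_poly_frob[of p w 1] by simp
  have "res p ^ Q = (\<Prod>w\<in>#proots G. poly (ac_poly p) w ^ Q)"
    unfolding res_def by (rule prod_mset_power_const[symmetric])
  also have "\<dots> = (\<Prod>w\<in>#proots G. poly (ac_poly p) (w ^ Q))"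
    by (simp only: frob1)
  also have "\<dots> = (\<Prod>w\<in>#image_mset (\<lambda>z. z ^ Q) (proots G). poly (ac_poly p) w)"
    by (simp add: multiset.map_comp o_def)
  also have "\<dots> = res p" by (simp only: frob_proots res_def)
  finally show ?thesis by (simp add: range_to_ac_eq)
qed

lemma lead_sign_in_range: "lead_sign \<in> range to_ac"
proof -
  have "lead_sign = to_ac (lead_coeff g * (- 1) ^ size (proots G))"
    by (simp add: lead_sign_def G_def)
  then show ?thesis by blast
qed

lemma lead_sign_nz: "lead_sign \<noteq> 0" using G_nz by (simp add: lead_sign_def)

lemma range_to_ac_power: "x \<in> range to_ac \<Longrightarrow> x ^ n \<in> range to_ac"
  by (auto simp flip: to_ac_power)

lemma chi_ac_mult:
  assumes "x \<in> range to_ac" "y \<in> range to_ac"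
  shows "chi_ac (x * y) = chi_ac x * chi_ac y"
proof -
  obtain a b where "x = to_ac a" "y = to_ac b" using assms by blast
  then show ?thesis by (simp add: chi_ac_def chi_mult flip: to_ac_mult)
qed

lemma chi_ac_1: "chi_ac 1 = 1" by (simp add: chi_ac_def)

lemma chi_ac_0: "chi_ac 0 = 0" by (simp add: chi_ac_def)

lemma chi_ac_power: "x \<in> range to_ac \<Longrightarrow> chi_ac (x ^ n) = chi_ac x ^ n"
  by (induction n) (auto simp: chi_ac_1 chi_ac_mult range_to_ac_power)

lemma norm_chi_ac: "x \<in> range to_ac \<Longrightarrow> x \<noteq> 0 \<Longrightarrow> norm (chi_ac x) = 1"
  by (auto simp: chi_ac_def norm_chi)

lemma res_mult: "res (p * q) = res p * res q"
  by (simp add: res_def prod_mset.distrib)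

lemma res_1: "res 1 = 1" by (simp add: res_def)

lemma res_eq_0_iff: "res p = 0 \<longleftrightarrow> (\<exists>w\<in>zeros. poly (ac_poly p) w = 0)"
  using G_nz by (auto simp: res_def prod_mset_zero_iff zeros_def)

lemma poly_G: "poly G x = lead_coeff G * (\<Prod>w\<in>#proots G. x - w)"
proof -
  have "poly G x = lead_coeff G * poly (\<Prod>w\<in>#proots G. [:-w, 1:]) x"
    by (subst size_proots_alg_closed(2)[OF G_nz]) simp
  also have "poly (\<Prod>w\<in>#proots G. [:-w, 1:]) x = (\<Prod>w\<in>#proots G. x - w)"
    by (simp add: poly_prod_mset multiset.map_comp o_def)
  finally show ?thesis .
qed

lemma poly_monic:
  assumes "p \<in> monics m"
  shows "poly (ac_poly p) x = (\<Prod>\<theta>\<in>#proots (ac_poly p). x - \<theta>)"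
proof -
  have nz: "ac_poly p \<noteq> 0" using monicsD(1)[OF assms] by simp
  have "poly (ac_poly p) x = poly (\<Prod>\<theta>\<in>#proots (ac_poly p). [:-\<theta>, 1:]) x"
    by (subst size_proots_alg_closed(2)[OF nz]) (use monicsD(3)[OF assms] in simp)
  then show ?thesis by (simp add: poly_prod_mset multiset.map_comp o_def)
qed

text \<open>Symmetry of the resultant: both sides are the double product of
  \<open>\<theta> - w\<close> over the roots of \<open>p\<close> and of \<open>G\<close>, up to the
  leading coefficient of \<open>G\<close> and signs.\<close>

lemma prod_G_roots:
  assumes "p \<in> monics m"
  shows "(\<Prod>\<theta>\<in>#proots (ac_poly p). poly G \<theta>) = lead_sign ^ m * res p"
proof -
  have nz: "ac_poly p \<noteq> 0" using monicsD(1)[OF assms] by simp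
  have sz: "size (proots (ac_poly p)) = m"
    using size_proots_alg_closed(1)[OF nz] monicsD(2)[OF assms] by simp
  have "(\<Prod>\<theta>\<in>#proots (ac_poly p). poly G \<theta>) =
      lead_coeff G ^ m * (\<Prod>\<theta>\<in>#proots (ac_poly p). \<Prod>w\<in>#proots G. \<theta> - w)"
    by (simp add: poly_G prod_mset.distrib sz)
  also have "(\<Prod>\<theta>\<in>#proots (ac_poly p). \<Prod>w\<in>#proots G. \<theta> - w) =
      (\<Prod>w\<in>#proots G. \<Prod>\<theta>\<in>#proots (ac_poly p). \<theta> - w)"
    by (rule prod_mset.swap)
  also have "\<dots> = (\<Prod>w\<in>#proots G. (- 1) ^ m * poly (ac_poly p) w)"
  proof (intro arg_cong[where f = prod_mset] image_mset_cong)
    fix w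
    have "(\<Prod>\<theta>\<in>#proots (ac_poly p). \<theta> - w) = (\<Prod>\<theta>\<in>#proots (ac_poly p). (- 1) * (w - \<theta>))"
      by simp
    also have "\<dots> = (- 1) ^ m * poly (ac_poly p) w"
      by (simp only: prod_mset.distrib poly_monic[OF assms] prod_mset_constant sz)
    finally show "(\<Prod>\<theta>\<in>#proots (ac_poly p). \<theta> - w) = (- 1) ^ m * poly (ac_poly p) w" .
  qed
  also have "\<dots> = ((- 1) ^ m) ^ size (proots G) * res p"
    by (simp add: prod_mset.distrib res_def)
  finally show ?thesis
    by (simp add: lead_sign_def power_mult_distrib mult.commute flip: power_mult)
qed

text \<open>For monic \<open>p\<close> this is the character at the product of \<open>G\<close> over
  the roots of \<open>p\<close>; the factor depending on the degree keeps it multiplicative.\<close>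

definition chi_poly :: "'a poly \<Rightarrow> complex" where "chi_poly p = chi_ac lead_sign ^ degree p * chi_ac (res p)"

lemma chi_poly_mult: "p \<noteq> 0 \<Longrightarrow> q \<noteq> 0 \<Longrightarrow> chi_poly (p * q) = chi_poly p * chi_poly q"
  by (simp add: chi_poly_def degree_mult_eq res_mult chi_ac_mult res_in_range power_add)

lemma chi_poly_1: "chi_poly 1 = 1" by (simp add: chi_poly_def res_1 chi_ac_1)

text \<open>\<open>G\<close> commutes with Frobenius, so its product over the conjugates of
  \<open>x\<close> is the norm of its value at \<open>x\<close>. This is the summand of
  \<open>char_sum (conj_degree x)\<close> at \<open>x\<close>.\<close>

lemma chi_poly_min_poly: "chi_poly (min_poly x) = chi_ac (poly G x ^ repunit (conj_degree x))"
proof -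
  have "chi_poly (min_poly x) = chi_ac (lead_sign ^ conj_degree x * res (min_poly x))"
    by (simp add: chi_poly_def degree_min_poly chi_ac_mult chi_ac_power lead_sign_in_range res_in_range range_to_ac_power)
  also have "lead_sign ^ conj_degree x * res (min_poly x) = (\<Prod>\<theta>\<in>#proots (ac_poly (min_poly x)). poly G \<theta>)"
    using prod_G_roots[of "min_poly x" "conj_degree x"] min_poly_power_in_monics[of x 1] by simp
  also have "proots (ac_poly (min_poly x)) = mset_set (conjugates x)"
    using proots_prod_linear[of "mset_set (conjugates x)"] by (simp add: min_poly prod_unfold_prod_mset)
  also have "(\<Prod>\<theta>\<in>#mset_set (conjugates x). poly G \<theta>) = (\<Prod>\<theta>\<in>conjugates x. poly G \<theta>)"
    by (simp add: prod_unfold_prod_mset)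
  also have "\<dots> = (\<Prod>i<conj_degree x. poly G (x ^ (Q ^ i)))"
    unfolding conjugates_def by (simp add: prod.reindex[OF inj_conjugates])
  also have "\<dots> = poly G x ^ repunit (conj_degree x)"
    by (simp add: G_def poly_ac_poly_frob repunit_def power_sum)
  finally show ?thesis .
qed

text \<open>Transitivity of the norm: \<open>y\<close> is fixed by the \<open>d\<close>-th iterate
  of Frobenius, so each of the \<open>j\<close> blocks of \<open>d\<close> conjugates contributes
  the same factor.\<close>

lemma power_repunit_mult:
  assumes "y \<in> fixfield d"
  shows "y ^ repunit (d * j) = (y ^ repunit d) ^ j"
proof (induction j)
  case (Suc j)
  have "y ^ repunit (d * Suc j) = y ^ repunit d * (y ^ (Q ^ d)) ^ repunit (d * j)"
    by (simp add: repunit_add power_add power_mult)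
  then show ?case using assms Suc by (simp add: fixfield_def)
qed (auto simp: repunit_def)

lemma chi_poly_min_poly_power: "chi_poly (min_poly x ^ j) = chi_ac (poly G x ^ repunit (conj_degree x * j))"
proof -
  have y: "poly G x \<in> fixfield (conj_degree x)" unfolding G_def by (rule ac_poly_in_fixfield[OF conj_degree(2)])
  have "chi_poly (min_poly x ^ j) = chi_poly (min_poly x) ^ j"
    by (induction j) (auto simp: chi_poly_1 chi_poly_mult min_poly_nz)
  also have "\<dots> = chi_ac ((poly G x ^ repunit (conj_degree x)) ^ j)"
    by (simp add: chi_poly_min_poly chi_ac_power power_repunit_in_range[OF y])
  finally show ?thesis by (simp add: power_repunit_mult[OF y])
qed

text \<open>The coefficient \<open>A\<^sub>m\<close> of the L-function.\<close>

definition monic_sum :: "nat \<Rightarrow> complex" where "monic_sum m = (\<Sum>p\<in>monics m. chi_poly p)"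

lemma monic_sum_0: "monic_sum 0 = 1" by (simp add: monic_sum_def monics_0 chi_poly_1)

text \<open>
  Reindexing of triples: a monic \<open>p\<close> of degree \<open>m\<close>, a root \<open>\<theta>\<close> of \<open>p\<close> and a \<open>j\<close> with
  \<open>min_poly \<theta> ^ j dvd p\<close> correspond to \<open>s = conj_degree \<theta> * j\<close>, the point \<open>\<theta> \<in> fixfield s\<close> and the
  cofactor of degree \<open>m - s\<close>.
\<close>
lemma newton_identity: "of_nat m * monic_sum m = (\<Sum>s=1..m. char_sum s * monic_sum (m - s))"
proof -
  define L where "L = (SIGMA p:monics m. SIGMA \<theta>:{\<theta>. poly (ac_poly p) \<theta> = 0}. {1..order \<theta> (ac_poly p)})"
  define R where "R = (SIGMA s:{1..m}. SIGMA \<theta>:fixfield s. monics (m - s))"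
  have finr: "finite {\<theta>. poly (ac_poly p) \<theta> = 0}" if "p \<in> monics m" for p
    using monicsD(1)[OF that] by (simp add: poly_roots_finite)
  \<comment> \<open>The factor \<open>m\<close> is the number of roots of \<open>p\<close> with
    multiplicity; the index \<open>j\<close> spreads out the multiplicity.\<close>
  have "of_nat m * monic_sum m = (\<Sum>p\<in>monics m. \<Sum>\<theta>\<in>{\<theta>. poly (ac_poly p) \<theta> = 0}. \<Sum>j\<in>{1..order \<theta> (ac_poly p)}. chi_poly p)"
    unfolding monic_sum_def sum_distrib_left
  proof (intro sum.cong refl)
    fix p assume p: "p \<in> monics m"
    have nz: "ac_poly p \<noteq> 0" using monicsD(1)[OF p] by simp
    have "m = size (proots (ac_poly p))" using size_proots_alg_closed(1)[OF nz] monicsD(2)[OF p] by simp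
    also have "\<dots> = (\<Sum>\<theta>\<in>{\<theta>. poly (ac_poly p) \<theta> = 0}. order \<theta> (ac_poly p))"
      using nz by (simp add: size_multiset_overloaded_eq)
    finally have "complex_of_nat m = (\<Sum>\<theta>\<in>{\<theta>. poly (ac_poly p) \<theta> = 0}. of_nat (order \<theta> (ac_poly p)))"
      by (metis of_nat_sum)
    then show "of_nat m * chi_poly p = (\<Sum>\<theta>\<in>{\<theta>. poly (ac_poly p) \<theta> = 0}. \<Sum>j\<in>{1..order \<theta> (ac_poly p)}. chi_poly p)"
      by (simp add: sum_distrib_right)
  qed
  also have "\<dots> = (\<Sum>(p, \<theta>, j)\<in>L. chi_poly p)"
    unfolding L_def using finite_monics finr by (intro sum_Sigma3) auto
  also have "\<dots> = (\<Sum>(s, \<theta>, p)\<in>R. chi_ac (poly G \<theta> ^ repunit s) * chi_poly p)"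
  proof (rule sum.reindex_bij_witness[of _ "\<lambda>(s, \<theta>, p). (min_poly \<theta> ^ (s div conj_degree \<theta>) * p, \<theta>, s div conj_degree \<theta>)"
        "\<lambda>(p, \<theta>, j). (conj_degree \<theta> * j, \<theta>, p div min_poly \<theta> ^ j)"], goal_cases)
    case prems: (1 x)
    then obtain p \<theta> j where x: "x = (p, \<theta>, j)" "p \<in> monics m" "j \<le> order \<theta> (ac_poly p)"
      by (auto simp: L_def)
    then have "min_poly \<theta> ^ j dvd p" by (intro min_poly_power_dvd) (auto simp: monicsD)
    then show ?case using conj_degree(1)[of \<theta>] by (simp add: x(1))
  next
    case prems: (2 x)
    then obtain p \<theta> j where x: "x = (p, \<theta>, j)" and p: "p \<in> monics m" "1 \<le> j" "j \<le> order \<theta> (ac_poly p)"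
      by (auto simp: L_def)
    have "min_poly \<theta> ^ j * (p div min_poly \<theta> ^ j) = p" using p by (intro dvd_mult_div_cancel min_poly_power_dvd) (auto simp: monicsD)
    then have "conj_degree \<theta> * j \<le> m" "p div min_poly \<theta> ^ j \<in> monics (m - conj_degree \<theta> * j)"
      using monics_dvd[OF _ min_poly_power_in_monics[of \<theta> j], of "p div min_poly \<theta> ^ j" m] p by auto
    then show ?case using p conj_degree(1)[of \<theta>] by (simp add: x R_def in_fixfield_iff)
  next
    case prems: (3 x)
    then obtain s \<theta> p where x: "x = (s, \<theta>, p)" "conj_degree \<theta> dvd s" by (auto simp: R_def in_fixfield_iff)
    then show ?case using min_poly_nz[of \<theta>] by simp
  next
    case prems: (4 x)
    then obtain s \<theta> p where x: "x = (s, \<theta>, p)" and s: "1 \<le> s" "s \<le> m" "conj_degree \<theta> dvd s" "p \<in> monics (m - s)"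
      by (auto simp: R_def in_fixfield_iff)
    define j where "j = s div conj_degree \<theta>"
    have sj: "s = conj_degree \<theta> * j" using s by (simp add: j_def)
    have j1: "j \<ge> 1" using sj s(1) by (cases j) auto
    have "min_poly \<theta> ^ j * p \<in> monics (conj_degree \<theta> * j + (m - s))"
      using s min_poly_power_in_monics by (intro monics_mult)
    then have M: "min_poly \<theta> ^ j * p \<in> monics m" using s by (simp flip: sj)
    have o: "order \<theta> (ac_poly (min_poly \<theta> ^ j * p)) = j + order \<theta> (ac_poly p)"
      using monicsD(1)[OF s(4)] by (simp add: order_mult min_poly_nz order_power order_min_poly)
    then have "poly (ac_poly (min_poly \<theta> ^ j * p)) \<theta> = 0"
      using j1 monicsD(1)[OF M] by (subst order_root) auto
    then show ?case using M j1 o by (simp add: x L_def flip: j_def)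
  next
    case prems: (5 x)
    then obtain p \<theta> j where x: "x = (p, \<theta>, j)" and p: "p \<in> monics m" "1 \<le> j" "j \<le> order \<theta> (ac_poly p)"
      by (auto simp: L_def)
    define h where "h = p div min_poly \<theta> ^ j"
    have h: "p = min_poly \<theta> ^ j * h" unfolding h_def
      using p by (intro dvd_mult_div_cancel[symmetric] min_poly_power_dvd) (auto simp: monicsD)
    then have "h \<noteq> 0" using monicsD(1)[OF p(1)] by auto
    then have "chi_poly p = chi_ac (poly G \<theta> ^ repunit (conj_degree \<theta> * j)) * chi_poly h"
      by (simp add: h chi_poly_mult min_poly_nz chi_poly_min_poly_power)
    then show ?case by (simp add: x h_def)
  qed
  also have "\<dots> = (\<Sum>s\<in>{1..m}. \<Sum>\<theta>\<in>fixfield s. \<Sum>p\<in>monics (m - s). chi_ac (poly G \<theta> ^ repunit s) * chi_poly p)"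
    unfolding R_def using finite_monics finite_card_fixfield(1) by (intro sum_Sigma3[symmetric]) auto
  also have "\<dots> = (\<Sum>s=1..m. char_sum s * monic_sum (m - s))"
    by (simp add: char_sum_def monic_sum_def sum_product)
  finally show ?thesis .
qed

end

section \<open>Weil's bound for multiplicative character sums\<close>

lemma poly_vanishing_many_roots:
  fixes p :: "'a::idom poly"
  assumes "degree p < card S" "\<And>x. x \<in> S \<Longrightarrow> poly p x = 0"
  shows "p = 0"
proof (rule ccontr)
  assume p: "p \<noteq> 0"
  have "card S \<le> card {x. poly p x = 0}"
    using assms(2) p by (intro card_mono poly_roots_finite) auto
  also have "\<dots> \<le> degree p" by (rule card_poly_roots_bound[OF p])
  finally show False using assms(1) by simp
qed

text \<open>
  The hypothesis says \<open>X L' = a L\<close> with \<open>a = \<Sum>k. s k X\<^sup>k\<close>. At a root of \<open>L\<close> inside the disc of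
  convergence of \<open>a\<close> the right-hand side would vanish to higher order than the left-hand side.
\<close>
lemma norm_root_ge_if_newton:
  fixes L :: "complex poly" and C \<rho> :: real
  assumes L0: "coeff L 0 = 1" and \<rho>: "\<rho> > 0"
    and newton: "\<And>m. of_nat m * coeff L m = (\<Sum>k=1..m. s k * coeff L (m - k))"
    and bound: "\<And>k. k > 0 \<Longrightarrow> norm (s k) \<le> C * \<rho> ^ k"
    and z: "poly L z = 0"
  shows "norm z * \<rho> \<ge> 1"
proof (rule ccontr)
  assume "\<not> norm z * \<rho> \<ge> 1"
  then have "norm z < 1 / \<rho>" using \<rho> by (simp add: field_simps)
  then obtain r where r: "norm z < r" "r < 1 / \<rho>" using dense by blast
  have r\<rho>: "r * \<rho> < 1" "r \<ge> 0" using r \<rho> norm_ge_zero[of z] by (auto simp: field_simps simp del: norm_ge_zero)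
  \<comment> \<open>The recurrence and the bound concern \<open>s k\<close> for positive
    \<open>k\<close>, so the constant term of the series is set to 0.\<close>
  define c where "c k = (if k = 0 then 0 else s k)" for k
  define a where "a x = (\<Sum>k. c k * x ^ k)" for x
  have L_nz: "L \<noteq> 0" using L0 by auto
  have c_bound: "norm (c k) \<le> \<bar>C\<bar> * \<rho> ^ k" for k
  proof (cases "k = 0")
    case False
    have "C * \<rho> ^ k \<le> \<bar>C\<bar> * \<rho> ^ k" using \<rho> by (intro mult_right_mono) auto
    then show ?thesis using bound[of k] False by (simp add: c_def)
  qed (auto simp: c_def)
  have summ: "summable (\<lambda>k. norm (c k * x ^ k))" if "norm x \<le> r" for x
  proof (rule summable_comparison_test')
    have "\<rho> * norm x \<le> \<rho> * r" using that \<rho> by (intro mult_left_mono) auto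
    then have "\<rho> * norm x < 1" using r\<rho> by (simp add: mult.commute)
    then have "norm (\<rho> * norm x) < 1" using \<rho> by simp
    then show "summable (\<lambda>k. \<bar>C\<bar> * (\<rho> * norm x) ^ k)" by (intro summable_mult summable_geometric)
    show "norm (norm (c k * x ^ k)) \<le> \<bar>C\<bar> * (\<rho> * norm x) ^ k" if "k \<ge> 0" for k
      using mult_right_mono[OF c_bound[of k], of "norm x ^ k"]
      by (simp add: norm_mult norm_power power_mult_distrib mult.assoc)
  qed
  \<comment> \<open>Both series converge absolutely, so their product is the Cauchy product, whose
    coefficients \<open>newton\<close> identifies with those of \<open>X L'\<close>.\<close>
  have eq: "x * poly (pderiv L) x = a x * poly L x" if x: "norm x \<le> r" for x
  proof -
    have polyL: "(\<lambda>m. coeff p m * x ^ m) sums poly p x" for p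
      unfolding poly_altdef by (rule sums_finite) (auto simp: coeff_eq_0)
    have "summable (\<lambda>m. norm (coeff L m * x ^ m))"
      by (rule summable_finite[of "{..degree L}"]) (auto simp: coeff_eq_0)
    then have "a x * poly L x = (\<Sum>m. \<Sum>i\<le>m. (c i * x ^ i) * (coeff L (m - i) * x ^ (m - i)))"
      using Cauchy_product[OF summ[OF x]] sums_unique[OF polyL] by (simp add: a_def)
    also have "\<dots> = (\<Sum>m. coeff (pCons 0 (pderiv L)) m * x ^ m)"
    proof (rule arg_cong[where f = suminf], rule ext)
      fix m
      have "(\<Sum>i\<le>m. (c i * x ^ i) * (coeff L (m - i) * x ^ (m - i))) = (\<Sum>i\<le>m. c i * coeff L (m - i) * x ^ m)"
      proof (intro sum.cong refl)
        fix i assume "i \<in> {..m}"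
        then have "x ^ m = x ^ i * x ^ (m - i)" by (simp flip: power_add)
        then show "(c i * x ^ i) * (coeff L (m - i) * x ^ (m - i)) = c i * coeff L (m - i) * x ^ m" by simp
      qed
      also have "\<dots> = (\<Sum>i=1..m. s i * coeff L (m - i)) * x ^ m"
        unfolding sum_distrib_right by (rule sum.mono_neutral_cong_right) (auto simp: c_def)
      also have "\<dots> = coeff (pCons 0 (pderiv L)) m * x ^ m"
        unfolding newton[symmetric] by (cases m) (auto simp: coeff_pderiv)
      finally show "(\<Sum>i\<le>m. (c i * x ^ i) * (coeff L (m - i) * x ^ (m - i))) = coeff (pCons 0 (pderiv L)) m * x ^ m" .
    qed
    also have "\<dots> = x * poly (pderiv L) x"
      using sums_unique[OF polyL[of "pCons 0 (pderiv L)"]] by simp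
    finally show ?thesis ..
  qed
  define n where "n = order z L"
  obtain M where M: "L = [:-z, 1:] ^ n * M" "\<not> [:-z, 1:] dvd M"
    using order_decomp[OF L_nz, of z] by (auto simp: n_def)
  have n: "n > 0" using z L_nz by (simp add: n_def order_gt_0_iff)
  have Mz: "poly M z \<noteq> 0" using M(2) by (simp add: poly_eq_0_iff_dvd)
  \<comment> \<open>The cofactor of \<open>(X - z) ^ (n - 1)\<close> in the derivative; its value at
    \<open>z\<close> is \<open>n * poly M z\<close>, which is nonzero.\<close>
  define H where "H = smult (of_nat n) M + [:-z, 1:] * pderiv M"
  have "pderiv L = [:-z, 1:] ^ (n - 1) * H"
  proof -
    have pd: "pderiv [:-z, 1:] = 1" by (simp add: pderiv_pCons)
    obtain k where k: "n = Suc k" using n by (cases n) auto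
    show ?thesis unfolding M(1) pderiv_mult k pderiv_power_Suc pd H_def
      by (simp add: algebra_simps del: mult_pCons_left mult_pCons_right)
  qed
  \<comment> \<open>Cancelling \<open>(x - z) ^ (n - 1)\<close> requires
    \<open>x \<noteq> z\<close>; the value at \<open>z\<close> is recovered below as a limit and
    yields \<open>z * poly H z = 0\<close>.\<close>
  then have eq2: "x * poly H x = a x * ((x - z) * poly M x)" if "norm x \<le> r" "x \<noteq> z" for x
  proof -
    have "poly L x = (x - z) ^ (n - 1) * ((x - z) * poly M x)"
    proof -
      have "poly L x = (x - z) ^ n * poly M x" by (subst M(1)) simp
      then show ?thesis using n by (cases n) auto
    qed
    moreover have "poly (pderiv L) x = (x - z) ^ (n - 1) * poly H x"
      using \<open>pderiv L = _\<close> by (simp del: mult_pCons_left)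
    ultimately have "(x - z) ^ (n - 1) * (x * poly H x) = (x - z) ^ (n - 1) * (a x * ((x - z) * poly M x))"
      using eq[OF that(1)] by (simp add: mult_ac)
    then show ?thesis using that(2) by simp
  qed
  have "summable (\<lambda>k. c k * complex_of_real r ^ k)"
  proof (rule summable_norm_cancel, rule summ)
    show "norm (complex_of_real r) \<le> r" using r\<rho>(2) by simp
  qed
  moreover have "norm z < norm (complex_of_real r)" using r(1) r\<rho> by simp
  ultimately have "isCont (\<lambda>x. \<Sum>k. c k * x ^ k) z" by (rule isCont_powser)
  then have "isCont a z" by (simp add: a_def[abs_def])
  then have "(\<lambda>x. a x * ((x - z) * poly M x)) \<midarrow>z\<rightarrow> a z * ((z - z) * poly M z)"
    by (intro tendsto_intros isContD poly_isCont)
  moreover have "eventually (\<lambda>x. a x * ((x - z) * poly M x) = x * poly H x) (at z)"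
  proof -
    have "a x * ((x - z) * poly M x) = x * poly H x" if "x \<noteq> z" "dist x z < r - norm z" for x
    proof -
      have "norm x \<le> norm (x - z) + norm z" by (metis diff_add_cancel norm_triangle_ineq)
      then have "norm x \<le> r" using that by (simp add: dist_norm)
      then show ?thesis using eq2 that by simp
    qed
    then show ?thesis
      unfolding eventually_at using r by (intro exI[of _ "r - norm z"]) auto
  qed
  ultimately have "(\<lambda>x. x * poly H x) \<midarrow>z\<rightarrow> 0"
    using Lim_transform_eventually by fastforce
  moreover have "(\<lambda>x. x * poly H x) \<midarrow>z\<rightarrow> z * poly H z"
    by (intro tendsto_intros isContD poly_isCont)
  ultimately have "z * poly H z = 0" using LIM_unique by blast
  moreover have "z \<noteq> 0" using z L0 by (auto simp: poly_0_coeff_0)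
  ultimately show False using Mz n by (simp add: H_def)
qed

text \<open>This coefficient is minus the sum of the reciprocals of the roots, each of norm at most
  \<rho>. Splitting off \<open>1 - X / z\<close> keeps the constant coefficient 1.\<close>

lemma norm_coeff_1_le_if_roots_ge:
  fixes L :: "complex poly" and \<rho> :: real
  assumes "coeff L 0 = 1" "\<rho> \<ge> 0" "\<And>z. poly L z = 0 \<Longrightarrow> norm z * \<rho> \<ge> 1"
  shows "norm (coeff L 1) \<le> degree L * \<rho>"
  using assms
proof (induction "degree L" arbitrary: L)
  case 0
  then show ?case by (simp add: coeff_eq_0)
next
  case (Suc n)
  obtain z where z: "poly L z = 0"
    using alg_closed_imp_poly_has_root[of L] Suc.hyps(2) by auto
  then have z0: "z \<noteq> 0" using Suc.prems(1) by (auto simp: poly_0_coeff_0)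
  obtain M where M: "L = [:-z, 1:] * M" using z by (auto simp: poly_eq_0_iff_dvd dvd_def)
  define N where "N = smult (- z) M"
  have L: "L = [:1, - 1 / z:] * N" using z0 by (simp add: M N_def smult_add_right algebra_simps)
  have N0: "N \<noteq> 0" using L Suc.hyps(2) by auto
  have "degree L = degree [:1, - 1 / z:] + degree N"
    unfolding L using N0 by (intro degree_mult_eq) auto
  then have deg: "n = degree N" using Suc.hyps(2) z0 by simp
  have "coeff N 0 = 1" using Suc.prems(1) by (simp add: L)
  moreover have "norm y * \<rho> \<ge> 1" if "poly N y = 0" for y
    using Suc.prems(3)[of y] that by (simp add: L)
  ultimately have IH: "norm (coeff N 1) \<le> degree N * \<rho>"
    using Suc.hyps(1)[OF deg] Suc.prems(2) by blast
  have "coeff L 1 = coeff N 1 - 1 / z" using \<open>coeff N 0 = 1\<close> by (simp add: L)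
  then have "norm (coeff L 1) \<le> norm (coeff N 1) + norm (1 / z)" by (simp add: norm_triangle_ineq4)
  moreover have "norm (1 / z) \<le> \<rho>"
    using Suc.prems(3)[OF z] z0 by (simp add: norm_divide field_simps)
  ultimately have "norm (coeff L 1) \<le> degree N * \<rho> + \<rho>" using IH by linarith
  then show ?case using Suc.hyps(2) deg by (simp add: algebra_simps flip: Suc.hyps(2))
qed

section \<open>Vanishing of the high coefficients of the L-function, and Weil's bound\<close>

context weil_sum
begin

text \<open>A conjugate of \<theta> is a root of \<open>G\<close> only if \<theta> is, so powers of
  \<open>min_poly \<theta>\<close> have nonzero \<open>res\<close> and \<open>chi_poly\<close>
  reduces there to its degree factor.\<close>

lemma chi_norm_if_res_trivial:
  assumes triv: "\<And>p. res p \<noteq> 0 \<Longrightarrow> chi_ac (res p) = 1"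
    and \<theta>: "\<theta> \<in> fixfield s" "\<theta> \<notin> zeros"
  shows "chi_ac (poly G \<theta> ^ repunit s) = chi_ac lead_sign ^ s"
proof -
  obtain j where j: "s = conj_degree \<theta> * j" using \<theta>(1) by (auto simp: in_fixfield_iff)
  have "res (min_poly \<theta>) \<noteq> 0"
  proof
    assume "res (min_poly \<theta>) = 0"
    then obtain v where v: "v \<in> zeros" "poly (ac_poly (min_poly \<theta>)) v = 0" by (auto simp: res_eq_0_iff)
    then have "v \<in> conjugates \<theta>" using conjugates(1)[of \<theta>] by (auto simp: min_poly poly_prod)
    then obtain i where "v = \<theta> ^ (Q ^ i)" by (auto simp: conjugates_def)
    then show False using v(1) \<theta>(2) by (auto simp: zeros_def G_def poly_ac_poly_frob)
  qed
  then have "res (min_poly \<theta> ^ j) \<noteq> 0" by (induction j) (auto simp: res_1 res_mult)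
  then have "chi_poly (min_poly \<theta> ^ j) = chi_ac lead_sign ^ (conj_degree \<theta> * j)"
    using triv monicsD(2)[OF min_poly_power_in_monics[of \<theta> j]] by (simp add: chi_poly_def)
  then show ?thesis by (simp add: chi_poly_min_poly_power j)
qed

text \<open>Otherwise \<open>norm (char_sum s)\<close> would be about \<open>Q ^ s\<close>, against the bound \<open>char_sum_bound\<close>.\<close>
lemma res_nontrivial: "\<exists>p. res p \<noteq> 0 \<and> chi_ac (res p) \<noteq> 1"
proof (rule ccontr)
  assume "\<not> ?thesis"
  then have triv: "\<And>p. res p \<noteq> 0 \<Longrightarrow> chi_ac (res p) = 1" by blast
  obtain C where C: "\<And>s. s > 0 \<Longrightarrow> norm (char_sum s) \<le> C * \<rho> ^ s" using char_sum_bound by blast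
  have ineq: "\<rho> ^ s \<le> C + card zeros" if s: "s > 0" for s
  proof -
    have fin: "finite (fixfield s)" by (rule finite_card_fixfield(1)[OF s])
    have "char_sum s = (\<Sum>\<theta>\<in>fixfield s - zeros. chi_ac (poly G \<theta> ^ repunit s))"
      unfolding char_sum_def using fin repunit_pos[OF s]
      by (intro sum.mono_neutral_right) (auto simp: zeros_def chi_ac_0 zero_power)
    also have "\<dots> = (\<Sum>\<theta>\<in>fixfield s - zeros. chi_ac lead_sign ^ s)"
      using chi_norm_if_res_trivial[OF triv] by (intro sum.cong) auto
    finally have "norm (char_sum s) = card (fixfield s - zeros)"
      by (simp add: norm_mult norm_power norm_chi_ac lead_sign_in_range lead_sign_nz)
    moreover have "Q ^ s \<le> card (fixfield s - zeros) + card zeros"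
      using card_Diff_subset_Int[of "fixfield s" zeros] finite_card_fixfield(2)[OF s] fin finite_zeros
        card_mono[OF finite_zeros, of "fixfield s \<inter> zeros"] by (simp add: finite_Int)
    then have "real Q ^ s \<le> real (card (fixfield s - zeros)) + card zeros"
      by (metis of_nat_add of_nat_le_iff of_nat_power)
    moreover have "real Q ^ s = \<rho> ^ s * \<rho> ^ s"
      by (simp add: rho(2)[symmetric] power2_eq_square power_mult_distrib)
    moreover have "1 \<le> \<rho> ^ s" using rho by simp
    then have "real (card zeros) * 1 \<le> card zeros * \<rho> ^ s" by (intro mult_left_mono) auto
    ultimately have "\<rho> ^ s * \<rho> ^ s \<le> (C + card zeros) * \<rho> ^ s"
      using C[OF s] by (simp add: algebra_simps)
    then show ?thesis using rho by simp
  qed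
  obtain s where "C + card zeros < \<rho> ^ s" using real_arch_pow[OF rho(1)] by blast
  moreover have "\<rho> ^ s \<le> \<rho> ^ Suc s" using rho(1) by (intro power_increasing) auto
  ultimately show False using ineq[of "Suc s"] by linarith
qed

text \<open>
  Multiplying the residue of \<open>p\<close> modulo the radical \<open>R\<close> of \<open>G\<close> by a fixed unit permutes the monic polynomials
  of degree \<open>m \<ge> degree R\<close> and multiplies the sum by a nontrivial character value.
\<close>
lemma monic_sum_eq_0:
  assumes m: "m \<ge> card zeros"
  shows "monic_sum m = 0"
proof -
  have frobW: "(\<lambda>z. z ^ Q) ` zeros = zeros"
  proof -
    have "zeros = set_mset (proots G)" using G_nz by (simp add: zeros_def)
    then show ?thesis using arg_cong[OF frob_proots, of set_mset] by simp
  qed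
  obtain R where R: "ac_poly R = (\<Prod>y\<in>zeros. [:-y, 1:])"
    using descend_poly[OF finite_zeros frobW] by blast
  have degR: "degree R = card zeros"
  proof -
    have "degree R = degree (ac_poly R)" by simp
    also have "\<dots> = (\<Sum>y\<in>zeros. degree [:-y, 1:])"
      unfolding R by (rule degree_prod_eq_sum_degree) auto
    finally show ?thesis by simp
  qed
  have R_root: "poly (ac_poly R) v = 0" if "v \<in> zeros" for v
    using that finite_zeros by (auto simp: R poly_prod)
  have "w \<in> zeros" using order_w g_nz by (auto simp: zeros_def G_def order_root)
  then have "card zeros > 0" using finite_zeros by (auto simp: card_gt_0_iff)
  then have degR0: "degree R > 0" by (simp add: degR)
  then have R0: "R \<noteq> 0" by auto
  have deg_mod: "degree (p mod R) < card zeros" for p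
    using degree_mod_less[OF R0, of p] degR0 degR by auto
  have poly_mod: "poly (ac_poly (p mod R)) v = poly (ac_poly p) v" if "v \<in> zeros" for p v
  proof -
    have "ac_poly p = ac_poly R * ac_poly (p div R) + ac_poly (p mod R)"
      by (metis ac_poly_add ac_poly_mult mult_div_mod_eq)
    then show ?thesis by (simp add: R_root[OF that])
  qed
  obtain U where U: "res U \<noteq> 0" "chi_ac (res U) \<noteq> 1" using res_nontrivial by blast
  have U_nz: "poly (ac_poly U) v \<noteq> 0" if "v \<in> zeros" for v
    using U(1) that by (auto simp: res_eq_0_iff)
  \<comment> \<open>The quotient by \<open>R\<close> is kept and the remainder multiplied by
    \<open>U\<close>. As \<open>degree R \<le> m\<close>, the leading term survives.\<close>
  define \<phi> where "\<phi> p = R * (p div R) + (U * p) mod R" for p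
  have res\<phi>: "res (\<phi> p) = res U * res p" for p
  proof -
    have "poly (ac_poly (\<phi> p)) v = poly (ac_poly (U * p)) v" if "v \<in> zeros" for v
      unfolding \<phi>_def ac_poly_add poly_add poly_mod[OF that] ac_poly_mult[of R] by (simp add: R_root[OF that])
    then have "res (\<phi> p) = res (U * p)"
      unfolding res_def using G_nz
      by (intro arg_cong[where f = prod_mset] image_mset_cong) (simp add: zeros_def)
    then show ?thesis by (simp add: res_mult)
  qed
  have \<phi>_Mon: "\<phi> p \<in> monics m" if p: "p \<in> monics m" for p
  proof -
    define \<delta> where "\<delta> = (U * p) mod R - p mod R"
    have "\<phi> p = p + \<delta>"
      by (simp add: \<phi>_def \<delta>_def algebra_simps minus_mod_eq_mult_div[symmetric])
    moreover have "degree \<delta> < degree p"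
      unfolding \<delta>_def
      using degree_diff_le_max[of "(U * p) mod R" "p mod R"] deg_mod[of p] deg_mod[of "U * p"] m monicsD(2)[OF p] by linarith
    ultimately have "degree (\<phi> p) = degree p" "lead_coeff (\<phi> p) = lead_coeff p"
      by (simp_all add: degree_add_eq_left coeff_eq_0)
    then show ?thesis using monicsD[OF p] by (simp add: monics_def)
  qed
  have inj: "inj_on \<phi> (monics m)"
  proof (rule inj_onI)
    fix p q assume pq: "p \<in> monics m" "q \<in> monics m" and eq: "\<phi> p = \<phi> q"
    have dv: "\<phi> x div R = x div R" "\<phi> x mod R = (U * x) mod R" for x
      using R0 by (simp_all add: \<phi>_def div_add1_eq[of "R * _"] mod_add_eq)
    have 1: "p div R = q div R" "(U * p) mod R = (U * q) mod R" using dv[of p] dv[of q] eq by auto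
    \<comment> \<open>\<open>U\<close> has no zero in \<open>zeros\<close>, so the two remainders
      agree at \<open>card zeros\<close> points, more than their degrees allow unless they are
      equal.\<close>
    have "p mod R - q mod R = 0"
    proof -
      have "ac_poly (p mod R - q mod R) = 0"
      proof (rule poly_vanishing_many_roots)
        show "degree (ac_poly (p mod R - q mod R)) < card zeros"
          using degree_diff_le_max[of "p mod R" "q mod R"] deg_mod[of p] deg_mod[of q] by simp
        fix v assume v: "v \<in> zeros"
        have "poly (ac_poly (U * p)) v = poly (ac_poly ((U * p) mod R)) v"
          by (rule poly_mod[OF v, symmetric])
        also have "\<dots> = poly (ac_poly (U * q)) v"
          unfolding 1(2) by (rule poly_mod[OF v])
        finally have "poly (ac_poly (U * p)) v = poly (ac_poly (U * q)) v" .
        then have "poly (ac_poly p) v = poly (ac_poly q) v" using U_nz[OF v] by auto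
        moreover have "ac_poly (p mod R) = ac_poly (p mod R - q mod R) + ac_poly (q mod R)"
          by (simp flip: ac_poly_add)
        ultimately show "poly (ac_poly (p mod R - q mod R)) v = 0"
          using poly_mod[OF v, of p] poly_mod[OF v, of q] by simp
      qed
      then show ?thesis by (simp only: ac_poly_eq_0_iff)
    qed
    then show "p = q" using 1(1) by (metis eq_iff_diff_eq_0 mult_div_mod_eq)
  qed
  have "bij_betw \<phi> (monics m) (monics m)"
    using inj \<phi>_Mon endo_inj_surj[OF finite_monics[of m], of \<phi>] by (auto simp: bij_betw_def)
  then have "monic_sum m = (\<Sum>p\<in>monics m. chi_poly (\<phi> p))"
    unfolding monic_sum_def by (rule sum.reindex_bij_betw[symmetric])
  also have "\<dots> = (\<Sum>p\<in>monics m. chi_ac (res U) * chi_poly p)"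
    using monicsD(2)[OF \<phi>_Mon] by (intro sum.cong refl)
      (auto simp: chi_poly_def res\<phi> chi_ac_mult res_in_range monicsD(2))
  also have "\<dots> = chi_ac (res U) * monic_sum m" by (simp add: monic_sum_def sum_distrib_left)
  finally show ?thesis using U(2) by simp
qed

lemma char_sum_1_eq: "char_sum 1 = (\<Sum>x\<in>UNIV. \<chi> (poly g x))"
proof -
  have F1: "fixfield 1 = range to_ac" by (simp add: fixfield_def range_to_ac_eq)
  show ?thesis
    unfolding char_sum_def F1 sum.reindex[OF inj_to_ac]
    by (simp add: repunit_def G_def poly_ac_poly_to_ac chi_ac_def)
qed

theorem weil_bound: "norm (\<Sum>x\<in>UNIV. \<chi> (poly g x)) \<le> (real (card zeros) - 1) * sqrt (real Q)"
proof -
  define L where "L = (\<Sum>m<card zeros. monom (monic_sum m) m)"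
  have L: "coeff L m = monic_sum m" for m
    using monic_sum_eq_0[of m] by (auto simp: L_def coeff_sum if_distrib cong: if_cong)
  have "w \<in> zeros" using order_w g_nz by (auto simp: zeros_def G_def order_root)
  then have W0: "card zeros > 0" using finite_zeros by (auto simp: card_gt_0_iff)
  have "degree L \<le> card zeros - 1" using L monic_sum_eq_0 by (intro degree_le) auto
  then have deg: "real (degree L) \<le> real (card zeros) - 1" using W0 by linarith
  obtain C where C: "\<And>s. s > 0 \<Longrightarrow> norm (char_sum s) \<le> C * \<rho> ^ s" using char_sum_bound by blast
  have roots: "norm z * \<rho> \<ge> 1" if "poly L z = 0" for z
    by (rule norm_root_ge_if_newton[where L = L and s = char_sum and C = C])
      (use that C rho in \<open>auto simp: L monic_sum_0 newton_identity\<close>)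
  have "coeff L 0 = 1" "\<rho> \<ge> 0" using rho by (auto simp: L monic_sum_0)
  then have "norm (coeff L 1) \<le> degree L * \<rho>"
    using roots by (rule norm_coeff_1_le_if_roots_ge)
  also have "\<dots> \<le> (real (card zeros) - 1) * \<rho>" using deg rho by (intro mult_right_mono) auto
  also have "coeff L 1 = char_sum 1" using newton_identity[of 1] by (simp add: L monic_sum_0)
  finally show ?thesis unfolding char_sum_1_eq \<rho>_def .
qed

end

section \<open>Power residues among the values of a polynomial\<close>

lemma cis_power_eq_1_iff:
  fixes n :: nat
  assumes "n > 0"
  shows "cis (2 * pi / n) ^ i = 1 \<longleftrightarrow> n dvd i"
proof -
  have one: "cis (2 * pi / n) ^ n = 1" using assms by (simp add: DeMoivre)
  have "i = n * (i div n) + i mod n" by simp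
  then have "cis (2 * pi / n) ^ i = (cis (2 * pi / n) ^ n) ^ (i div n) * cis (2 * pi / n) ^ (i mod n)"
    by (metis power_add power_mult)
  then have eq: "cis (2 * pi / n) ^ i = cis (2 * pi * real (i mod n) / n)"
    by (simp add: one) (simp add: DeMoivre mult_ac)
  have inj: "inj_on (\<lambda>k. cis (2 * pi * real k / real n)) {..<n}"
    using bij_betw_roots_unity[OF assms] by (rule bij_betw_imp_inj_on)
  show ?thesis
  proof
    assume "cis (2 * pi / n) ^ i = 1"
    then have "cis (2 * pi * real (i mod n) / n) = cis (2 * pi * real 0 / n)" using eq by simp
    then have "i mod n = 0"
      using assms by (intro inj_onD[OF inj]) auto
    then show "n dvd i" by (simp add: dvd_eq_mod_eq_0)
  next
    assume "n dvd i"
    then show "cis (2 * pi / n) ^ i = 1" using eq by (simp add: dvd_eq_mod_eq_0)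
  qed
qed

lemma sum_geometric_root_of_unity:
  fixes \<zeta> :: complex
  assumes "\<zeta> ^ n = 1" "\<zeta> \<noteq> 1"
  shows "(\<Sum>t<n. \<zeta> ^ t) = 0"
  using assms geometric_sum[of \<zeta> n] by simp

text \<open>Cyclicity of the multiplicative group, transferred from carrier-based algebra to the
  type class.\<close>

lemma finite_field_ex_generator:
  "\<exists>\<gamma> :: 'a::{finite,field}. \<gamma> \<noteq> 0 \<and> (\<forall>x. x \<noteq> 0 \<longrightarrow> (\<exists>i::nat. x = \<gamma> ^ i))"
proof -
  define R where "R = (ring_of_type_algebra :: 'a ring)"
  interpret R: Ring.field R unfolding R_def by (rule field_from_type_algebra)
  have pw: "x [^]\<^bsub>R\<^esub> i = x ^ i" for x :: 'a and i :: nat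
    by (induction i) (auto simp: R_def ring_of_type_algebra_def mult.commute)
  have c: "carrier (Multiplicative_Group.mult_of R) = UNIV - {0}"
    by (auto simp: R_def ring_of_type_algebra_def)
  have "finite (carrier R)" by (auto intro: finite_subset[of _ UNIV])
  from R.finite_field_mult_group_has_gen[OF this]
  obtain \<gamma> where \<gamma>: "\<gamma> \<in> carrier (Multiplicative_Group.mult_of R)" "carrier (Multiplicative_Group.mult_of R) = {\<gamma> [^]\<^bsub>R\<^esub> i | i::nat. i \<in> UNIV}"
    by blast
  have "\<exists>i::nat. x = \<gamma> ^ i" if "x \<noteq> 0" for x
  proof -
    have "x \<in> {\<gamma> [^]\<^bsub>R\<^esub> i | i::nat. i \<in> UNIV}" unfolding \<gamma>(2)[symmetric] c using that by simp
    then show ?thesis by (auto simp: pw)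
  qed
  moreover have "\<gamma> \<noteq> 0" using \<gamma>(1) unfolding c by simp
  ultimately show ?thesis by blast
qed

context finite_field_closure
begin

text \<open>The sum of the characters \<open>\<chi> t\<close> vanishes at every element that is not
  a nonzero \<open>D\<close>-th power. If no value of \<open>g\<close> qualified, the total over all
  \<open>y\<close> would be 0; but the trivial character contributes at least \<open>Q - M\<close>,
  and Weil's bound makes the others too small to cancel it.\<close>

lemma ex_power_residue_value:
  fixes g :: "'a poly" and w :: "'a alg_closure" and c :: 'a
  defines "M \<equiv> card {x. poly (ac_poly g) x = 0}"
  assumes g: "g \<noteq> 0" "order w (ac_poly g) = 1" and D: "D > 0" and c: "c \<noteq> 0"
    and bound: "(real D - 1) * (real M - 1) * sqrt Q < real Q - real M"
  shows "\<exists>y u. u \<noteq> 0 \<and> poly g y = c * u ^ D"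
proof (rule ccontr)
  assume no: "\<not> ?thesis"
  obtain \<gamma> :: 'a where \<gamma>: "\<gamma> \<noteq> 0" "\<And>x. x \<noteq> 0 \<Longrightarrow> \<exists>i::nat. x = \<gamma> ^ i"
    using finite_field_ex_generator by blast
  define N where "N = Q - 1"
  have N: "N > 0" using Q_gt_1 by (simp add: N_def)
  have pow1: "\<gamma> ^ N = 1"
    using \<gamma>(1) power_Suc[of \<gamma> "Q - 1"] Q_gt_1 by (simp add: N_def)
  have pmod: "\<gamma> ^ i = \<gamma> ^ (i mod N)" for i
  proof -
    have "\<gamma> ^ i = \<gamma> ^ (N * (i div N) + i mod N)" by simp
    also have "\<dots> = (\<gamma> ^ N) ^ (i div N) * \<gamma> ^ (i mod N)" by (simp only: power_add power_mult)
    finally show ?thesis by (simp add: pow1)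
  qed
  have inj: "inj_on (\<lambda>i. \<gamma> ^ i) {..<N}"
  proof (rule eq_card_imp_inj_on)
    have "(\<lambda>i. \<gamma> ^ i) ` {..<N} = UNIV - {0}"
    proof (intro equalityI subsetI)
      fix x assume "x \<in> UNIV - {0 :: 'a}"
      then obtain i :: nat where "x = \<gamma> ^ i" using \<gamma>(2) by blast
      then have "x = \<gamma> ^ (i mod N)" using pmod by simp
      then show "x \<in> (\<lambda>i. \<gamma> ^ i) ` {..<N}" using N by simp
    qed (use \<gamma>(1) in auto)
    then show "card ((\<lambda>i. \<gamma> ^ i) ` {..<N}) = card {..<N}"
      by (simp add: card_Diff_singleton N_def Q_def)
  qed auto
  \<comment> \<open>A discrete logarithm, determined only modulo \<open>N\<close>. Since
    \<open>E\<close> divides \<open>N\<close>, powers of \<zeta> do not depend on the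
    choice.\<close>
  define ind where "ind x = (SOME i. x = \<gamma> ^ i)" for x
  have ind: "x = \<gamma> ^ ind x" if "x \<noteq> 0" for x
    unfolding ind_def using someI_ex[OF \<gamma>(2)[OF that]] .
  define E where "E = gcd D N"
  have E: "E > 0" "E dvd N" "E \<le> D" using N D by (auto simp: E_def gcd_le1_nat)
  define \<zeta> where "\<zeta> = cis (2 * pi / E)"
  have \<zeta>1: "\<zeta> ^ E = 1" using cis_power_eq_1_iff[OF E(1), of E] by (simp add: \<zeta>_def)
  have \<zeta>mod: "\<zeta> ^ i = \<zeta> ^ (i mod N)" for i
  proof -
    have "\<zeta> ^ N = 1" using cis_power_eq_1_iff[OF E(1), of N] E(2) by (simp add: \<zeta>_def)
    moreover have "\<zeta> ^ i = \<zeta> ^ (N * (i div N) + i mod N)" by simp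
    ultimately show ?thesis by (simp only: power_add power_mult power_one mult_1)
  qed
  have \<zeta>ind: "\<zeta> ^ ind (\<gamma> ^ i) = \<zeta> ^ i" for i
  proof -
    have "\<gamma> ^ i = \<gamma> ^ ind (\<gamma> ^ i)" using \<gamma>(1) by (intro ind) simp
    then have "\<gamma> ^ (i mod N) = \<gamma> ^ (ind (\<gamma> ^ i) mod N)" using pmod by metis
    then have "i mod N = ind (\<gamma> ^ i) mod N" using N by (intro inj_onD[OF inj]) auto
    then show ?thesis using \<zeta>mod by metis
  qed
  \<comment> \<open>The \<open>t\<close>-th power of a character of exact order \<open>E\<close>,
    with value 0 at 0 even for \<open>t = 0\<close>.\<close>
  define \<chi> where "\<chi> t x = (if x = 0 then 0 else \<zeta> ^ (t * ind x))" for t x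
  have \<chi>_gen: "\<chi> t (\<gamma> ^ i) = (\<zeta> ^ i) ^ t" for t i
    using \<gamma>(1) \<zeta>ind[of i] by (simp add: \<chi>_def power_mult mult.commute[of t])
  have \<chi>_mult: "\<chi> t (x * y) = \<chi> t x * \<chi> t y" for t x y
  proof (cases "x = 0 \<or> y = 0")
    case False
    then obtain i j where "x = \<gamma> ^ i" "y = \<gamma> ^ j" using \<gamma>(2) by metis
    then show ?thesis by (simp add: \<chi>_gen power_mult_distrib flip: power_add) (simp add: power_add power_mult_distrib)
  qed (auto simp: \<chi>_def)
  have sum_\<chi>: "(\<Sum>t<E. \<chi> t x) = 0" if "\<not> (\<exists>u. u \<noteq> 0 \<and> x = u ^ D)" for x
  proof (cases "x = 0")
    case False
    then obtain i where x: "x = \<gamma> ^ i" using \<gamma>(2) by metis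
    have "\<not> E dvd i"
    proof
      assume "E dvd i"
      then obtain j where j: "i = E * j" by blast
      \<comment> \<open>By Bezout \<open>D * a\<close> is congruent to \<open>E\<close> modulo
        \<open>N\<close>, so every \<open>E\<close>-th power is a \<open>D\<close>-th power.\<close>
      obtain a b where ab: "D * a = N * b + E" using bezout_nat[of D N] D by (auto simp: E_def)
      have "(\<gamma> ^ (a * j)) ^ D = \<gamma> ^ (D * a * j)" by (simp add: mult_ac flip: power_mult)
      also have "D * a * j = N * (b * j) + i" by (simp add: ab j algebra_simps)
      also have "\<gamma> ^ \<dots> = x" by (simp add: power_add power_mult pow1 x)
      finally show False using that \<gamma>(1) by (metis power_not_zero)
    qed
    then have "\<zeta> ^ i \<noteq> 1" using cis_power_eq_1_iff[OF E(1)] by (simp add: \<zeta>_def)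
    moreover have "(\<zeta> ^ i) ^ E = 1" using \<zeta>1 by (metis mult.commute power_mult power_one)
    ultimately show ?thesis
      unfolding x \<chi>_gen by (intro sum_geometric_root_of_unity)
  qed (simp add: \<chi>_def)
  define P where "P t = (\<Sum>y\<in>UNIV. \<chi> t (poly g y))" for t
  have "(\<Sum>y\<in>UNIV. \<Sum>t<E. \<chi> t (inverse c * poly g y)) = 0"
  proof (rule sum.neutral, rule ballI, rule sum_\<chi>, rule notI)
    fix y assume "\<exists>u. u \<noteq> 0 \<and> inverse c * poly g y = u ^ D"
    then obtain u where "u \<noteq> 0" "poly g y = c * u ^ D" using c by (auto simp: field_simps)
    then show False using no by blast
  qed
  then have sum0: "(\<Sum>t<E. \<chi> t (inverse c) * P t) = 0"
    by (subst (asm) sum.swap) (simp add: \<chi>_mult P_def sum_distrib_left)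
  have norm_\<chi>: "norm (\<chi> t (inverse c)) = 1" for t
    using c by (simp add: \<chi>_def norm_power \<zeta>_def)
  have W_pos: "M \<ge> 1"
  proof -
    have "w \<in> {x. poly (ac_poly g) x = 0}" using g by (simp add: order_root)
    moreover have "finite {x. poly (ac_poly g) x = 0}" using g by (simp add: poly_roots_finite)
    ultimately have "M > 0" unfolding M_def by (auto simp: card_gt_0_iff)
    then show ?thesis by simp
  qed
  have weil: "norm (P t) \<le> (real M - 1) * sqrt Q" if t: "0 < t" "t < E" for t
  proof -
    have "\<chi> t 1 = 1" using \<chi>_gen[of t 0] by simp
    moreover have "\<chi> t \<gamma> \<noteq> 1"
      using \<chi>_gen[of t 1] cis_power_eq_1_iff[OF E(1), of t] t by (auto simp: \<zeta>_def dest: dvd_imp_le)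
    ultimately interpret weil_sum T Q e "\<chi> t" g w
      using \<gamma>(1) g by unfold_locales (auto simp: \<chi>_mult, simp add: \<chi>_def)
    show ?thesis using weil_bound by (simp add: P_def M_def zeros_def G_def)
  qed
  have P0: "norm (P 0) \<ge> real Q - real M"
  proof -
    have "P 0 = (\<Sum>y\<in>UNIV. if poly g y = 0 then 0 else 1)"
      by (simp add: P_def \<chi>_def cong: if_cong)
    also have "\<dots> = of_nat (card {y. poly g y \<noteq> 0})"
      by (simp add: sum.If_cases Collect_neg_eq)
    finally have "norm (P 0) = real (card {y. poly g y \<noteq> 0})" by simp
    moreover have "Q = card {y. poly g y \<noteq> 0} + card {y. poly g y = 0}"
      unfolding Q_def by (subst card_Un_disjoint[symmetric]) (auto intro: arg_cong[where f = card])
    moreover have "card {y. poly g y = 0} \<le> M"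
      unfolding M_def using g
      by (intro card_inj_on_le[of to_ac]) (auto simp: poly_ac_poly_to_ac poly_roots_finite intro: inj_on_subset[OF inj_to_ac])
    ultimately show ?thesis by linarith
  qed
  have "(\<Sum>t<E. \<chi> t (inverse c) * P t) = \<chi> 0 (inverse c) * P 0 + (\<Sum>t\<in>{..<E} - {0}. \<chi> t (inverse c) * P t)"
    using E(1) by (intro sum.remove) auto
  then have "\<chi> 0 (inverse c) * P 0 = - (\<Sum>t\<in>{..<E} - {0}. \<chi> t (inverse c) * P t)"
    using sum0 by (simp add: eq_neg_iff_add_eq_0)
  then have "norm (P 0) = norm (\<Sum>t\<in>{..<E} - {0}. \<chi> t (inverse c) * P t)"
    using norm_\<chi>[of 0] by (metis norm_minus_cancel norm_mult mult_1)
  also have "\<dots> \<le> (\<Sum>t\<in>{..<E} - {0}. (real M - 1) * sqrt Q)"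
    using weil by (intro sum_norm_le) (auto simp: norm_mult norm_\<chi>)
  also have "\<dots> = (real E - 1) * ((real M - 1) * sqrt Q)"
    using E(1) by (simp add: card_Diff_singleton of_nat_diff)
  also have "\<dots> \<le> (real D - 1) * ((real M - 1) * sqrt Q)"
    using E(3) W_pos by (intro mult_right_mono) auto
  finally show False using P0 bound by (simp add: mult.assoc)
qed

end

section \<open>Linearized polynomials\<close>

text \<open>Translation by 1 permutes the field; comparing the sums of all elements shows that the
  cardinality is 0 in the field.\<close>

lemma CHAR_finite_field_eq:
  assumes "prime p" "card (UNIV :: 'a::{finite,field} set) = p ^ m"
  shows "CHAR('a) = p"
proof -
  have "(\<Sum>x\<in>UNIV. x :: 'a) = (\<Sum>x\<in>UNIV. x + 1)"
    by (rule sum.reindex_bij_witness[of _ "\<lambda>x. x + 1" "\<lambda>x. x - 1"]) auto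
  then have "of_nat (card (UNIV :: 'a set)) = (0 :: 'a)"
    by (simp add: sum.distrib)
  then have "CHAR('a) dvd p ^ m"
    using assms(2) by (simp only: of_nat_eq_0_iff_char_dvd)
  moreover have "prime CHAR('a)"
    using finite_imp_CHAR_pos[where ?'a = 'a] prime_CHAR_semidom by auto
  ultimately show ?thesis
    using assms(1) by (metis prime_dvd_power primes_dvd_imp_eq)
qed

context finite_field_closure
begin

text \<open>The derivative is the constant \<open>b 0\<close>, so every root is simple. The cofactor
  \<open>H\<close> of \<open>X\<close> has positive degree and takes the value \<open>b 0\<close> at
  0, so it has a nonzero root, which stays simple after multiplication by powers of
  \<open>X\<close>.\<close>

lemma linearized_ex_simple_root:
  fixes b :: "nat \<Rightarrow> 'a" and q R :: nat
  defines "p \<equiv> \<Sum>j\<le>R. monom (b j) (q ^ j)"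
  assumes q: "CHAR('a) dvd q" and q2: "q \<ge> 2" and R: "R \<ge> 1" and b: "b 0 \<noteq> 0" "b R \<noteq> 0"
  shows "degree p = q ^ R" "\<exists>w. w \<noteq> 0 \<and> order w (ac_poly p) = 1"
proof -
  have lt: "q ^ j < q ^ R" if "j < R" for j
    using that q2 by (intro power_strict_increasing) auto
  have "p = (\<Sum>j<R. monom (b j) (q ^ j)) + monom (b R) (q ^ R)"
    by (simp add: p_def lessThan_Suc_atMost[symmetric])
  moreover have "degree (\<Sum>j<R. monom (b j) (q ^ j)) < degree (monom (b R) (q ^ R))"
  proof -
    have "degree (\<Sum>j<R. monom (b j) (q ^ j)) \<le> q ^ R - 1"
    proof (rule degree_sum_le)
      fix j assume "j \<in> {..<R}"
      then show "degree (monom (b j) (q ^ j)) \<le> q ^ R - 1"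
        using lt[of j] degree_monom_le[of "b j" "q ^ j"] by simp
    qed auto
    also have "\<dots> < q ^ R" using q2 by simp
    finally show ?thesis using b by (simp add: degree_monom_eq)
  qed
  ultimately show deg: "degree p = q ^ R"
    using b by (simp add: degree_add_eq_right degree_monom_eq)
  have "poly p 0 = 0"
    unfolding p_def poly_sum poly_monom by (rule sum.neutral) (use q2 in auto)
  then have "[:- 0, 1:] dvd p" by (simp only: poly_eq_0_iff_dvd)
  then obtain H where H: "p = [:0, 1:] * H" by (auto simp: dvd_def)
  have p0: "p \<noteq> 0" using deg q2 by auto
  then have H0: "H \<noteq> 0" using H by auto
  have pdp: "pderiv p = [:b 0:]"
  proof -
    have z: "of_nat (q ^ j) = (0 :: 'a)" if "j > 0" for j
      unfolding of_nat_eq_0_iff_char_dvd using q that by (metis dvd_power dvd_trans)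
    have "pderiv p = (\<Sum>j\<le>R. pderiv (monom (b j) (q ^ j)))"
      unfolding p_def using sum_comp_morphism[of pderiv "\<lambda>j. monom (b j) (q ^ j)" "{..R}"]
      by (simp add: pderiv_add o_def)
    also have "\<dots> = (\<Sum>j\<le>R. if j = 0 then [:b 0:] else 0)"
      using z by (intro sum.cong) (auto simp: pderiv_monom monom_0 simp del: of_nat_power)
    finally show ?thesis by simp
  qed
  have "q ^ 1 \<le> q ^ R" using q2 R by (intro power_increasing) auto
  moreover have "degree p = 1 + degree H" using H H0 by (simp add: degree_pCons_eq)
  ultimately have "degree (ac_poly H) > 0" using deg q2 by simp
  then obtain w where w: "poly (ac_poly H) w = 0"
    using alg_closed_imp_poly_has_root by blast
  have "w \<noteq> 0"
  proof
    assume "w = 0"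
    then have "poly (ac_poly H) (to_ac 0) = 0" using w by simp
    then have "poly H 0 = 0" by (simp only: poly_ac_poly_to_ac to_ac_eq_0_iff)
    then have "coeff (pderiv p) 0 = 0" by (simp add: H pderiv_mult pderiv_pCons poly_0_coeff_0)
    then show False using b by (simp add: pdp)
  qed
  moreover have "order w (ac_poly p) = 1"
  proof (rule order_eq_1_if_pderiv)
    show "poly (ac_poly p) w = 0" using w unfolding H ac_poly_mult by simp
    have "pderiv (ac_poly p) = ac_poly (pderiv p)"
      by (intro poly_eqI) (simp add: coeff_pderiv)
    then show "poly (pderiv (ac_poly p)) w \<noteq> 0" using b by (simp add: pdp map_poly_pCons)
  qed
  ultimately show "\<exists>w. w \<noteq> 0 \<and> order w (ac_poly p) = 1" by blast
qed

text \<open>The quotient of the linearized polynomial by \<open>y ^ (q ^ h)\<close> must be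
  \<open>c\<close> times a \<open>D\<close>-th power. Division becomes multiplication by
  \<open>X ^ E\<close>, which adds no zero because \<open>p\<close> already vanishes at 0, so at
  most \<open>q ^ R\<close> distinct zeros remain.\<close>

lemma linearized_power_residue:
  fixes b :: "nat \<Rightarrow> 'a" and q n k R h :: nat and c :: 'a
  assumes q: "CHAR('a) dvd q" and q2: "q \<ge> 2" and Qq: "Q = q ^ n" and R: "R \<ge> 1" and k: "k \<ge> 1"
    and b: "b 0 \<noteq> 0" "b R \<noteq> 0" and c: "c \<noteq> 0" and bound: "2 * (k + R) \<le> n"
  shows "\<exists>x y. x \<noteq> 0 \<and> y \<noteq> 0 \<and> (\<Sum>j\<le>R. b j * y ^ (q ^ j)) = c * x ^ (q ^ k - 1) * y ^ (q ^ h)"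
proof -
  define p where "p = (\<Sum>j\<le>R. monom (b j) (q ^ j))"
  \<comment> \<open>\<open>y ^ E\<close> is the inverse of \<open>y ^ (q ^ h)\<close> for \<open>y \<noteq> 0\<close>\<close>
  define E where "E = q ^ h * (Q - 2)"
  define g where "g = monom 1 E * p"
  obtain w where w: "w \<noteq> 0" "order w (ac_poly p) = 1"
    using linearized_ex_simple_root(2)[of q R b] assms by (auto simp: p_def)
  have deg: "degree p = q ^ R" using linearized_ex_simple_root(1)[of q R b] assms by (simp add: p_def)
  then have p0: "p \<noteq> 0" using q2 by auto
  have g0: "g \<noteq> 0" using p0 by (simp add: g_def)
  have poly_p: "poly p y = (\<Sum>j\<le>R. b j * y ^ (q ^ j))" for y
    by (simp add: p_def poly_sum poly_monom)
  have poly_p0: "poly p 0 = 0"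
    unfolding poly_p by (rule sum.neutral) (use q2 in auto)
  have acg: "ac_poly g = monom 1 E * ac_poly p" by (simp add: g_def map_poly_monom)
  have "order w (monom 1 E) = 0" using w by (intro order_0I) (simp add: poly_monom)
  then have ord: "order w (ac_poly g) = 1"
    using p0 w unfolding acg by (subst order_mult) auto
  define M where "M = card {x. poly (ac_poly g) x = 0}"
  have p00: "poly (ac_poly p) 0 = 0"
    using poly_ac_poly_to_ac[of p 0] poly_p0 by simp
  have "{x. poly (ac_poly g) x = 0} = {x. poly (ac_poly p) x = 0}"
    using p00 by (auto simp: acg poly_monom)
  then have M: "M \<le> q ^ R"
    unfolding M_def using card_poly_roots_bound[of "ac_poly p"] p0 deg by simp
  have M1: "M \<ge> 1"
  proof -
    have "w \<in> {x. poly (ac_poly g) x = 0}" using ord g0 by (simp add: order_root)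
    moreover have "finite {x. poly (ac_poly g) x = 0}" using g0 by (simp add: poly_roots_finite)
    ultimately have "M > 0" unfolding M_def by (auto simp: card_gt_0_iff)
    then show ?thesis by simp
  qed
  define D where "D = q ^ k - 1"
  have "q ^ 1 \<le> q ^ k" using k q2 by (intro power_increasing) auto
  then have D: "D > 0" "real D + 1 = real q ^ k" using q2 by (auto simp: D_def of_nat_diff)
  define s where "s = sqrt (real Q)"
  define B where "B = real q ^ R"
  have s2: "s * s = real Q" by (simp add: s_def)
  \<comment> \<open>Here \<open>(D + 1) * B = q ^ (k + R)\<close>, and \<open>bound\<close> says
    exactly that this is at most \<open>sqrt Q\<close>. The slack between \<open>D * B\<close> and
    \<open>(D + 1) * B\<close> absorbs the term \<open>M\<close>.\<close>
  have "(real q ^ (k + R))\<^sup>2 = real q ^ (2 * (k + R))" by (simp add: power_mult[symmetric] mult.commute)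
  also have "\<dots> \<le> real q ^ n" using bound q2 by (intro power_increasing) auto
  also have "\<dots> = real Q" by (simp add: Qq)
  finally have sB: "(real D + 1) * B \<le> s"
    unfolding s_def by (intro real_le_rsqrt) (simp add: D B_def power_add)
  have B1: "B \<ge> 1" using q2 by (simp add: B_def)
  have s1: "s \<ge> 1" unfolding s_def using Q_gt_1 by simp
  have MB: "real M \<le> B" using M by (metis B_def of_nat_le_iff of_nat_power)
  have "(real D - 1) * (real M - 1) * s \<le> (real D - 1) * B * s"
    using D MB s1 M1 by (intro mult_right_mono mult_left_mono) auto
  also have "\<dots> < real D * B * s" using B1 s1 by simp
  also have "\<dots> \<le> ((real D + 1) * B) * s - B"
    using mult_left_mono[OF s1, of B] B1 by (simp add: algebra_simps)
  also have "\<dots> \<le> s * s - real M"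
    using mult_right_mono[OF sB, of s] s1 MB by linarith
  finally have "(real D - 1) * (real M - 1) * sqrt Q < real Q - real M" by (simp only: s2 s_def[symmetric])
  then obtain y u where yu: "u \<noteq> 0" "poly g y = c * u ^ D"
    using ex_power_residue_value[OF g0 ord D(1) c] unfolding M_def by blast
  have y0: "y \<noteq> 0"
  proof
    assume "y = 0"
    then have "poly g y = 0" using poly_p0 by (simp add: g_def)
    then show False using yu c by simp
  qed
  have "y ^ (Q - 1) = 1"
    using y0 power_Suc[of y "Q - 1"] Q_gt_1 by simp
  moreover have "E + q ^ h = (Q - 1) * q ^ h"
    using Q_gt_1 by (cases Q) (auto simp: E_def algebra_simps)
  ultimately have "y ^ E * y ^ (q ^ h) = 1" by (simp add: power_mult flip: power_add)
  then have "poly p y = poly g y * y ^ (q ^ h)"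
    by (simp add: g_def poly_monom mult_ac)
  then show ?thesis using yu y0 by (intro exI[of _ u] exI[of _ y]) (simp add: poly_p D_def)
qed

end

text \<open>\<open>c\<close> is the coefficient sequence of \<open>f y - \<beta> * y ^ (q ^ h)\<close>.\<close>
lemma top_index_of_difference:
  fixes a :: "nat \<Rightarrow> 'a::field"
  assumes d: "a d \<noteq> 0" and supp: "\<forall>i>d. a i = 0" and nonmono: "\<not> is_monomial d a"
    and h: "h > ell d a" and binom: "is_binomial d a \<and> h = d \<longrightarrow> a h \<noteq> \<beta>"
  defines "c \<equiv> (\<lambda>i. a i - (if i = h then \<beta> else 0))"
  shows "\<forall>i<ell d a. c i = 0" "c (ell d a) \<noteq> 0"
    "\<exists>m>ell d a. m \<le> m_h h d a \<beta> \<and> c m \<noteq> 0 \<and> (\<forall>i>m. c i = 0)"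
proof -
  define Z where "Z = lin_support d a"
  define l where "l = ell d a"
  have Z: "finite Z" "d \<in> Z" "i \<in> Z \<longleftrightarrow> a i \<noteq> 0" for i
    using d supp by (auto simp: Z_def lin_support_def) (meson leI)
  have l: "l = Min Z" by (simp add: l_def ell_def Z_def)
  have lZ: "l \<in> Z" unfolding l using Z by (intro Min_in) auto
  have lmin: "l \<le> i" if "i \<in> Z" for i unfolding l using Z that by (intro Min_le) auto
  have hl: "h > l" using h by (simp add: l_def)
  show "\<forall>i<ell d a. c i = 0"
  proof (intro allI impI)
    fix i assume "i < ell d a"
    then have "i \<notin> Z" "i \<noteq> h" using lmin[of i] hl by (auto simp: l_def)
    then show "c i = 0" using Z(3) by (simp add: c_def)
  qed
  show "c (ell d a) \<noteq> 0"
    using lZ hl Z(3) unfolding c_def l_def[symmetric] by simp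
  have ld: "l < d"
  proof -
    have "Z \<noteq> {d}" using nonmono by (auto simp: is_monomial_def Z_def)
    then obtain i where "i \<in> Z" "i \<noteq> d" using Z(2) by blast
    moreover have "i \<le> d" using \<open>i \<in> Z\<close> by (auto simp: Z_def lin_support_def)
    ultimately show ?thesis using lmin[of i] by linarith
  qed
  have "\<exists>m>l. m \<le> m_h h d a \<beta> \<and> c m \<noteq> 0 \<and> (\<forall>i>m. c i = 0)"
  proof (cases "a d \<noteq> \<beta> \<or> d \<noteq> h")
    case True
    \<comment> \<open>Only \<open>m \<le> m_h h d a \<beta>\<close> can be claimed: for
      \<open>d < h\<close> and \<beta> = 0 the top index is \<open>d\<close>, below
      \<open>max d h\<close>.\<close>
    define Y where "Y = {i. i \<le> max d h \<and> c i \<noteq> 0}"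
    have Y: "finite Y" "d \<in> Y" using True d by (auto simp: Y_def c_def)
    have out: "c i = 0" if "i > max d h" for i using that supp by (auto simp: c_def)
    have mx: "Max Y \<in> Y" using Y by (intro Max_in) auto
    have "c i = 0" if i: "i > Max Y" for i
    proof (rule ccontr)
      assume "c i \<noteq> 0"
      then have "i \<in> Y" using out[of i] by (auto simp: Y_def not_less[symmetric])
      then show False using Max_ge[OF Y(1)] i by (simp add: leD)
    qed
    moreover have "Max Y > l" using Max_ge[OF Y] ld by linarith
    moreover have "i \<le> max d h \<and> c i \<noteq> 0" if "i \<in> Y" for i
      using that by (simp add: Y_def)
    then have "Max Y \<le> m_h h d a \<beta>" "c (Max Y) \<noteq> 0"
      using mx True by (auto simp: m_h_def)
    ultimately show ?thesis by blast
  next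
    case False
    then have dh: "d = h" "a d = \<beta>" by auto
    define m where "m = Max (Z - {d})"
    have mh: "m_h h d a \<beta> = m" using dh by (simp add: m_h_def ell3_def m_def Z_def)
    \<comment> \<open>The leading terms cancel here. Excluding binomials leaves a support index
      strictly between \<open>l\<close> and \<open>d\<close>, so the new top index still exceeds
      \<open>l\<close>.\<close>
    have "card Z \<noteq> 2" using binom dh by (auto simp: is_binomial_def Z_def)
    then have "Z \<noteq> {l, d}" using ld by auto
    then obtain i where i: "i \<in> Z" "i \<noteq> l" "i \<noteq> d" using Z(2) lZ by blast
    have fin: "finite (Z - {d})" "i \<in> Z - {d}" using Z i by auto
    have mZ: "m \<in> Z - {d}" unfolding m_def using fin by (intro Max_in) auto
    have "i \<le> m" unfolding m_def using fin by (rule Max_ge)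
    then have "m > l" using i lmin[of i] by linarith
    moreover have "c m \<noteq> 0" using mZ Z(3) dh by (auto simp: c_def)
    moreover have "c j = 0" if "j > m" for j
    proof (cases "j = d")
      case False
      then have "j \<notin> Z" using Max_ge[OF fin(1), of j] that by (auto simp: m_def)
      then show ?thesis using \<open>j \<noteq> d\<close> dh Z(3)[of j] by (auto simp: c_def)
    next
      case True
      then show ?thesis using dh by (auto simp: c_def)
    qed
    ultimately show ?thesis using mh by blast
  qed
  then show "\<exists>m>ell d a. m \<le> m_h h d a \<beta> \<and> c m \<noteq> 0 \<and> (\<forall>i>m. c i = 0)" by (simp add: l_def)
qed

section \<open>Points of the projective line and the common point of the two sets\<close>

lemma pg_point_scale:
  assumes "c \<noteq> 0"
  shows "pg_point (c * u) (c * v) = pg_point u v"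
proof (intro equalityI subsetI)
  fix x assume "x \<in> pg_point (c * u) (c * v)"
  then obtain z where "x = (z * (c * u), z * (c * v))" by (auto simp: pg_point_def)
  then have "x = ((z * c) * u, (z * c) * v)" by (simp add: mult.assoc)
  then show "x \<in> pg_point u v" unfolding pg_point_def by blast
next
  fix x assume "x \<in> pg_point u v"
  then obtain z where "x = (z * u, z * v)" by (auto simp: pg_point_def)
  then have "x = (z / c * (c * u), z / c * (c * v))" using assms by simp
  then show "x \<in> pg_point (c * u) (c * v)" unfolding pg_point_def by blast
qed

theorem theorem3p12:
  fixes q n k d h :: nat
    and \<alpha> \<beta> :: "'a::{finite,field}"
    and a :: "nat \<Rightarrow> 'a"
  assumes q_pp: "\<exists>p r. prime p \<and> r > 0 \<and> q = p ^ r"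
    and n2: "n \<ge> 2"
    and card: "card (UNIV :: 'a set) = q ^ n"
    and alpha: "\<alpha> \<noteq> 0"
    and k: "1 \<le> k" "k < n"
    and d: "d < n" "a d \<noteq> 0"
    and supp: "\<forall>i>d. a i = 0"
    and nonmono: "\<not> is_monomial d a"
    and h: "h < n" "h > ell d a"
    and binom: "is_binomial d a \<and> h = d \<longrightarrow> a h \<noteq> \<beta>"
    and bound: "2 * (int k + int (m_h h d a \<beta>) - int (ell d a)) \<le> int n"
  shows "L_g (\<lambda>x. \<alpha> * x ^ (q ^ k) + \<beta> * x) \<inter> L_f q h (linpoly q d a) \<noteq> {}"
proof -
  obtain p r where pr: "prime p" "r > 0" "q = p ^ r" using q_pp by blast
  have q2: "q \<ge> 2" using pr by (metis one_less_power prime_gt_1_nat Suc_1 Suc_leI One_nat_def)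
  have CHAR: "CHAR('a) = p"
    using CHAR_finite_field_eq[OF pr(1), of "r * n"] card pr(3) by (simp add: power_mult)
  interpret finite_field_closure "TYPE('a)" "q ^ n" "r * n"
    by unfold_locales (simp_all add: card CHAR pr(3) power_mult)
  define l where "l = ell d a"
  define c where "c i = a i - (if i = h then \<beta> else 0)" for i
  note top = top_index_of_difference[OF d(2) supp nonmono h(2) binom, folded c_def l_def]
  obtain m where m: "m > l" "m \<le> m_h h d a \<beta>" "c m \<noteq> 0" "\<forall>i>m. c i = 0" using top(3) by blast
  define R where "R = m - l"
  \<comment> \<open>Raising to the power \<open>q ^ (n * l)\<close> is the identity on the field, so
    \<open>x ^ (q ^ (n * l - l))\<close> is a root.\<close>
  have frob_surj: "\<exists>z. z ^ (q ^ l) = x" for x :: 'a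
  proof -
    have "(x ^ (q ^ (n * l - l))) ^ (q ^ l) = x ^ ((q ^ n) ^ l)"
      using n2 by (simp flip: power_mult power_add)
    then show ?thesis by (metis power_Q_power)
  qed
  \<comment> \<open>The \<open>q ^ l\<close>-th root of the equation shifts all exponents down by
    \<open>l\<close>: the lowest index becomes 0, which gives separability, and \<open>h\<close>
    becomes \<open>h - l\<close>, a true difference since \<open>l < h\<close>.\<close>
  have "\<forall>j. \<exists>z. z ^ (q ^ l) = c (l + j)" using frob_surj by blast
  then obtain b where b: "\<And>j. b j ^ (q ^ l) = c (l + j)" using choice by metis
  obtain \<alpha>' where \<alpha>': "\<alpha>' ^ (q ^ l) = \<alpha>" using frob_surj by blast
  have ql: "q ^ l > 0" using q2 by simp
  have "b 0 \<noteq> 0" "b R \<noteq> 0" "\<alpha>' \<noteq> 0"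
    using b[of 0] b[of R] top(2) m \<alpha>' alpha ql by (auto simp: R_def zero_power)
  moreover have "CHAR('a) dvd q" using CHAR pr by simp
  moreover have "2 * (k + R) \<le> n" using bound m by (simp add: R_def l_def)
  moreover have "R \<ge> 1" using m by (simp add: R_def)
  ultimately obtain x y where xy: "x \<noteq> 0" "y \<noteq> 0"
    "(\<Sum>j\<le>R. b j * y ^ (q ^ j)) = \<alpha>' * x ^ (q ^ k - 1) * y ^ (q ^ (h - l))"
    using linearized_power_residue[of q n R k b \<alpha>' "h - l"] q2 k by auto
  \<comment> \<open>Raising the solved equation to the power \<open>q ^ l\<close> restores the
    original coefficients; \<open>y\<close> is kept and \<open>x\<close> is replaced by
    \<open>X'\<close>.\<close>
  define X' where "X' = x ^ (q ^ l)"
  have CHARprime: "prime CHAR('a)" using CHAR pr by simp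
  have ql_eq: "q ^ l = CHAR('a) ^ (r * l)" by (simp add: CHAR pr(3) power_mult)
  have "(\<Sum>j\<le>R. b j * y ^ (q ^ j)) ^ (q ^ l) = (\<Sum>j\<le>R. c (l + j) * y ^ (q ^ (l + j)))"
    unfolding freshmans_dream_sum'[OF CHARprime ql_eq]
    by (intro sum.cong refl) (simp add: power_mult_distrib b power_add mult.commute flip: power_mult)
  also have "\<dots> = (\<Sum>i\<in>{l..m}. c i * y ^ (q ^ i))"
    by (rule sum.reindex_bij_witness[of _ "\<lambda>i. i - l" "\<lambda>j. l + j"]) (use m in \<open>auto simp: R_def\<close>)
  also have "\<dots> = (\<Sum>i\<le>max m (max d h). c i * y ^ (q ^ i))"
    using top(1) m(4) by (intro sum.mono_neutral_left) auto
  also have "\<dots> = (\<Sum>i\<le>max m (max d h). a i * y ^ (q ^ i)) - (\<Sum>i\<le>max m (max d h). (if i = h then \<beta> * y ^ (q ^ i) else 0))"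
    unfolding sum_subtractf[symmetric] by (intro sum.cong refl) (simp add: c_def algebra_simps)
  also have "(\<Sum>i\<le>max m (max d h). a i * y ^ (q ^ i)) = linpoly q d a y"
    unfolding linpoly_def using supp by (intro sum.mono_neutral_right) auto
  also have "(\<Sum>i\<le>max m (max d h). (if i = h then \<beta> * y ^ (q ^ i) else 0)) = \<beta> * y ^ (q ^ h)"
    by (simp add: sum.delta)
  finally have "linpoly q d a y - \<beta> * y ^ (q ^ h) = (\<alpha>' * x ^ (q ^ k - 1) * y ^ (q ^ (h - l))) ^ (q ^ l)"
    by (simp add: xy(3))
  also have "\<dots> = \<alpha> * X' ^ (q ^ k - 1) * y ^ (q ^ h)"
  proof -
    have "q ^ (h - l) * q ^ l = q ^ h" using h(2) by (simp add: l_def flip: power_add)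
    then have "(y ^ (q ^ (h - l))) ^ (q ^ l) = y ^ (q ^ h)" by (simp flip: power_mult)
    moreover have "(x ^ (q ^ k - 1)) ^ (q ^ l) = X' ^ (q ^ k - 1)"
      by (simp add: X'_def mult.commute flip: power_mult)
    ultimately show ?thesis by (simp only: power_mult_distrib \<alpha>')
  qed
  finally have fy: "linpoly q d a y = y ^ (q ^ h) * (\<alpha> * X' ^ (q ^ k - 1) + \<beta>)"
    by (simp add: algebra_simps)
  have X0: "X' \<noteq> 0" using xy(1) by (simp add: X'_def)
  have "X' ^ (q ^ k) = X' * X' ^ (q ^ k - 1)"
    using q2 by (simp flip: power_Suc)
  then have gx: "\<alpha> * X' ^ (q ^ k) + \<beta> * X' = X' * (\<alpha> * X' ^ (q ^ k - 1) + \<beta>)"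
    by (simp add: algebra_simps)
  \<comment> \<open>The common slope: both points have nonzero first coordinate and normalize to
    \<open>pg_point 1 z\<close>.\<close>
  define z where "z = \<alpha> * X' ^ (q ^ k - 1) + \<beta>"
  have "pg_point (y ^ (q ^ h)) (linpoly q d a y) = pg_point 1 z"
    using pg_point_scale[of "y ^ (q ^ h)" 1 z] xy(2) by (simp add: fy z_def)
  moreover have "pg_point X' (\<alpha> * X' ^ (q ^ k) + \<beta> * X') = pg_point 1 z"
    using pg_point_scale[OF X0, of 1 z] by (simp add: gx z_def)
  ultimately have "pg_point X' (\<alpha> * X' ^ (q ^ k) + \<beta> * X') = pg_point (y ^ (q ^ h)) (linpoly q d a y)"
    by simp
  then have "pg_point X' (\<alpha> * X' ^ (q ^ k) + \<beta> * X') \<in> L_f q h (linpoly q d a)"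
    using xy(2) by (auto simp: L_f_def)
  moreover have "pg_point X' (\<alpha> * X' ^ (q ^ k) + \<beta> * X') \<in> L_g (\<lambda>x. \<alpha> * x ^ (q ^ k) + \<beta> * x)"
    using X0 by (auto simp: L_g_def)
  ultimately show ?thesis by blast
qed

end
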